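(* For every $n\ge1$, the homology of the pointed partition poset $\Pi_P(n)$ with coefficients in $k$ is the $\mathbb{S}_n$-module $$H_l(\Pi_P(n))\cong\begin{cases}\mathcal{P}relie(n)^*\otimes\mathrm{sgn}_{\mathbb{S}_n}&\text{if } l=n-1,\\ 0&\text{otherwise.}\end{cases}$$
   Context: $k$ denotes $\mathbb{Z}$, $\mathbb{Q}$, $\mathbb{F}_p$ or a field of characteristic $0$. A pointed partition of $[n]$ is a set partition of $[n]$ in which exactly one element of each block is emphasized. In $\Pi_P(n)$, $\lambda\le\mu$ iff $\mu$ refines $\lambda$ as a partition and every pointed element of $\lambda$ is pointed in $\mu$; its maximal element is $\{\{\bar1\},\dots,\{\bar n\}\}$ and its minimal elements are the one-block pointed partitions; $\mathbb{S}_n$ acts by relabelling. $H_l(\Pi)$ is the homology of the complex spanned by chains $\lambda_0<\cdots<\lambda_l$ with $\lambda_0$ minimal and $\lambda_l$ maximal, differential $\sum_{0<i<l}(-1)^id_i$, $d_i$ omitting $\lambda_i$. $\mathcal{P}relie$ is the operad of PreLie algebras: one binary operation $\circ$ with $(x\circ y)\circ z-x\circ(y\circ z)=(x\circ z)\circ y-x\circ(z\circ y)$; $\mathcal{P}relie(n)$ is its arity-$n$ component (multilinear operations in $n$ variables), a right $\mathbb{S}_n$-module; $\mathrm{sgn}_{\mathbb{S}_n}$ is the sign representation. *)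

theory Defs
  imports Main "HOL-Combinatorics.Permutations" "HOL-Computational_Algebra.Primes"
begin

text \<open>k is Z, Q, F_p or a field of characteristic 0. Q is a field of characteristic 0.
  A type is (isomorphic to) Z iff the canonical map from int is bijective;
  it is (isomorphic to) F_p iff it is a field of prime characteristic p with p elements.\<close>

definition is_field_type :: "'k::comm_ring_1 itself \<Rightarrow> bool" where
  "is_field_type _ \<longleftrightarrow> (\<forall>x::'k. x \<noteq> 0 \<longrightarrow> (\<exists>y. x * y = 1))"

definition admissible_coeffs :: "'k::comm_ring_1 itself \<Rightarrow> bool" where
  "admissible_coeffs T \<longleftrightarrow>
     bij (of_int :: int \<Rightarrow> 'k)
   \<or> (is_field_type T \<and> CHAR('k) = 0)
   \<or> (is_field_type T \<and> prime CHAR('k) \<and> finite (UNIV :: 'k set)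
        \<and> card (UNIV :: 'k set) = CHAR('k))"

text \<open>A pointed partition of [n] = {1..n}: a set of pairs (block, pointed element).\<close>
type_synonym ppart = "(nat set \<times> nat) set"

definition pointed_partition :: "nat \<Rightarrow> ppart \<Rightarrow> bool" where
  "pointed_partition n P \<longleftrightarrow>
     (\<forall>(B, p) \<in> P. B \<noteq> {} \<and> p \<in> B)
   \<and> (\<forall>(B, p) \<in> P. \<forall>(C, q) \<in> P. (B, p) \<noteq> (C, q) \<longrightarrow> B \<inter> C = {})
   \<and> \<Union> (fst ` P) = {1..n}"

definition pparts :: "nat \<Rightarrow> ppart set" where
  "pparts n = {P. pointed_partition n P}"

definition pp_le :: "ppart \<Rightarrow> ppart \<Rightarrow> bool" where
  "pp_le P Q \<longleftrightarrow> (\<forall>C \<in> fst ` Q. \<exists>B \<in> fst ` P. C \<subseteq> B) \<and> snd ` P \<subseteq> snd ` Q"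

definition pp_less :: "ppart \<Rightarrow> ppart \<Rightarrow> bool" where
  "pp_less P Q \<longleftrightarrow> pp_le P Q \<and> P \<noteq> Q"

definition pp_minimal :: "nat \<Rightarrow> ppart \<Rightarrow> bool" where
  "pp_minimal n P \<longleftrightarrow> pointed_partition n P \<and> card P = 1"

definition pp_max :: "nat \<Rightarrow> ppart" where
  "pp_max n = (\<lambda>i. ({i}, i)) ` {1..n}"

definition pchains :: "nat \<Rightarrow> nat \<Rightarrow> ppart list set" where
  "pchains n l = {xs. length xs = Suc l \<and> set xs \<subseteq> pparts n
      \<and> (\<forall>i < l. pp_less (xs ! i) (xs ! Suc i))
      \<and> pp_minimal n (hd xs) \<and> last xs = pp_max n}"

text \<open>Chain group C_l with coefficients in k: functions supported on pchains n l
  (a finite set), i.e. the free k-module on these chains.\<close>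
definition chain_grp :: "nat \<Rightarrow> nat \<Rightarrow> (ppart list \<Rightarrow> 'k::comm_ring_1) set" where
  "chain_grp n l = {c. \<forall>x. x \<notin> pchains n l \<longrightarrow> c x = 0}"

definition del_at :: "nat \<Rightarrow> 'a list \<Rightarrow> 'a list" where
  "del_at i xs = take i xs @ drop (Suc i) xs"

definition bdry :: "nat \<Rightarrow> nat \<Rightarrow> (ppart list \<Rightarrow> 'k::comm_ring_1) \<Rightarrow> (ppart list \<Rightarrow> 'k)" where
  "bdry n l c = (\<lambda>y. \<Sum>x \<in> pchains n l. c x *
       (\<Sum>i \<in> {1..<l}. if del_at i x = y then (-1) ^ i else 0))"

definition cycles :: "nat \<Rightarrow> nat \<Rightarrow> (ppart list \<Rightarrow> 'k::comm_ring_1) set" where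
  "cycles n l = {c \<in> chain_grp n l. bdry n l c = (\<lambda>_. 0)}"

definition boundaries :: "nat \<Rightarrow> nat \<Rightarrow> (ppart list \<Rightarrow> 'k::comm_ring_1) set" where
  "boundaries n l = bdry n (Suc l) ` chain_grp n (Suc l)"

definition relabel_pp :: "(nat \<Rightarrow> nat) \<Rightarrow> ppart \<Rightarrow> ppart" where
  "relabel_pp g P = (\<lambda>(B, p). (g ` B, g p)) ` P"

text \<open>Left action on chains: sigma . [x] = [sigma x].\<close>
definition chain_act :: "(nat \<Rightarrow> nat) \<Rightarrow> (ppart list \<Rightarrow> 'k::comm_ring_1) \<Rightarrow> (ppart list \<Rightarrow> 'k)" where
  "chain_act \<sigma> c = (\<lambda>y. c (map (relabel_pp (inv \<sigma>)) y))"

text \<open>Monomials in the free magma with one binary operation: Node a b stands for a \<circ> b.\<close>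
datatype btree = Leaf nat | Node btree btree

fun leaves :: "btree \<Rightarrow> nat list" where
  "leaves (Leaf i) = [i]"
| "leaves (Node a b) = leaves a @ leaves b"

text \<open>Multilinear monomials in the variables x_1..x_n: each variable exactly once.
  The free k-module on these is the arity-n part of the free operad on one binary operation.\<close>
definition mtrees :: "nat \<Rightarrow> btree set" where
  "mtrees n = {t. distinct (leaves t) \<and> set (leaves t) = {1..n}}"

fun relabel_t :: "(nat \<Rightarrow> nat) \<Rightarrow> btree \<Rightarrow> btree" where
  "relabel_t g (Leaf i) = Leaf (g i)"
| "relabel_t g (Node a b) = Node (relabel_t g a) (relabel_t g b)"

text \<open>One-hole contexts, for generating the operadic ideal.\<close>
datatype bctx = Hole | CL bctx btree | CR btree bctx

fun fill :: "bctx \<Rightarrow> btree \<Rightarrow> btree" where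
  "fill Hole t = t"
| "fill (CL K b) t = Node (fill K t) b"
| "fill (CR a K) t = Node a (fill K t)"

definition ind :: "btree \<Rightarrow> btree \<Rightarrow> 'k::comm_ring_1" where
  "ind t s = (if s = t then 1 else 0)"

text \<open>The PreLie relation (x o y) o z - x o (y o z) - (x o z) o y + x o (z o y)
  with arbitrary monomials substituted and placed in an arbitrary context.\<close>
definition prelie_gen :: "bctx \<Rightarrow> btree \<Rightarrow> btree \<Rightarrow> btree \<Rightarrow> (btree \<Rightarrow> 'k::comm_ring_1)" where
  "prelie_gen K a b c = (\<lambda>s.
       ind (fill K (Node (Node a b) c)) s - ind (fill K (Node a (Node b c))) s
     - ind (fill K (Node (Node a c) b)) s + ind (fill K (Node a (Node c b))) s)"

definition prelie_gens :: "nat \<Rightarrow> (btree \<Rightarrow> 'k::comm_ring_1) set" where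
  "prelie_gens n = {prelie_gen K a b c | K a b c. fill K (Node (Node a b) c) \<in> mtrees n}"

text \<open>The k-submodule R(n) spanned by the generators; PreLie(n) = F(n)/R(n).\<close>
inductive_set prelie_rel :: "nat \<Rightarrow> (btree \<Rightarrow> 'k::comm_ring_1) set" for n where
  zero: "(\<lambda>_. 0) \<in> prelie_rel n"
| step: "g \<in> prelie_gens n \<Longrightarrow> r \<in> prelie_rel n \<Longrightarrow> (\<lambda>s. a * g s + r s) \<in> prelie_rel n"

text \<open>The dual PreLie(n)^* = Hom_k(F(n)/R(n), k): k-linear forms on the free module F(n)
  (determined by their values on the basis mtrees n) vanishing on R(n).\<close>
definition prelie_dual :: "nat \<Rightarrow> (btree \<Rightarrow> 'k::comm_ring_1) set" where
  "prelie_dual n = {f. (\<forall>t. t \<notin> mtrees n \<longrightarrow> f t = 0)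
      \<and> (\<forall>r \<in> prelie_rel n. (\<Sum>t \<in> mtrees n. r t * f t) = 0)}"

text \<open>Left S_n-action on PreLie(n)^* \<otimes> sgn: (sigma f)(mu) = sgn(sigma) f(mu . sigma), where
  mu . sigma = relabel (inv sigma) mu is the right action of PreLie(n).\<close>
definition dual_sgn_act :: "(nat \<Rightarrow> nat) \<Rightarrow> (btree \<Rightarrow> 'k::comm_ring_1) \<Rightarrow> (btree \<Rightarrow> 'k)" where
  "dual_sgn_act \<sigma> f = (\<lambda>t. of_int (sign \<sigma>) * f (relabel_t (inv \<sigma>) t))"

text \<open>H_l = Z_l / B_l is isomorphic as k[S_n]-module to M: there is a k-linear,
  S_n-equivariant surjection Z_l \<rightarrow> M whose kernel is B_l.\<close>
definition homology_iso ::
  "nat \<Rightarrow> nat \<Rightarrow> (btree \<Rightarrow> 'k::comm_ring_1) set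
     \<Rightarrow> ((nat \<Rightarrow> nat) \<Rightarrow> (btree \<Rightarrow> 'k) \<Rightarrow> (btree \<Rightarrow> 'k)) \<Rightarrow> bool" where
  "homology_iso n l M act \<longleftrightarrow> (\<exists>\<phi> :: (ppart list \<Rightarrow> 'k) \<Rightarrow> (btree \<Rightarrow> 'k).
      \<phi> ` cycles n l = M
    \<and> (\<forall>c \<in> cycles n l. \<forall>d \<in> cycles n l. \<forall>a b.
          \<phi> (\<lambda>x. a * c x + b * d x) = (\<lambda>t. a * \<phi> c t + b * \<phi> d t))
    \<and> (\<forall>c \<in> cycles n l. \<phi> c = (\<lambda>_. 0) \<longleftrightarrow> c \<in> boundaries n l)
    \<and> (\<forall>\<sigma>. \<sigma> permutes {1..n} \<longrightarrow>
          (\<forall>c \<in> cycles n l. \<phi> (chain_act \<sigma> c) = act \<sigma> (\<phi> c))))"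

end

theory Submission
  imports Defs
begin

text \<open>
  Below the top degree: fix the minimal element of the chains and remove both ends. Read from
  its maximal element downwards, the poset is semimodular: two different elements covered by \<open>y\<close> and
  above \<open>x\<close> both cover a common element above \<open>x\<close>. Hence the elements lying below some member of a
  nonempty set \<open>S\<close> of coatoms are built by adding one cone at a time, and a new cone meets the
  previous ones in a complex of the same kind inside a shorter interval; a Mayer-Vietoris argument
  shows that only the top homology survives, over every commutative ring.

  In top degree: a maximal chain is a sequence of merges \<open>(p, q)\<close> of blocks, and such a sequence is a
  binary tree together with an ordering of its inner vertices. The cycle condition at an interval
  of length two says either that exchanging two independent merges changes the sign, or that the
  four ways of merging three blocks into one sum to zero. After multiplying by the sign of the order in
  which the points disappear, the first condition says that the value depends only on the tree, and
  the second is the dual of the PreLie relation.\<close>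

subsection \<open>The augmented order complex\<close>

text \<open>The signs in the PreLie relation come from one count. The words
  \<open>(a,b)(a,d)\<close>, \<open>(a,d)(a,b)\<close>, \<open>(b,d)(a,b)\<close>,
  \<open>(d,b)(a,d)\<close> all merge three blocks into one pointed at \<open>a\<close>, and the
  points disappear in the orders b,d; d,b; d,b; b,d. Multiplying by the sign of this order turns the
  plain sum of the cycle condition into + - - +, which is the relation on (AB)D, (AD)B, A(BD),
  A(DB). The same factor cancels the sign change under exchange of independent merges. Relabelling
  by a permutation composes the order with that permutation, which is where the twist by the sign
  representation comes from. One tree has many words, so the map is defined through a canonical word
  of each tree. It is usable because every word can be brought to the canonical word of its tree by
  exchanges of independent letters. Since there are no chains in degree \<open>n\<close>, the top
  homology is the module of cycles itself; it is identified with the dual directly, without a basis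
  of PreLie(n) or a rank count.\<close>

fun diff :: "'a set \<Rightarrow> ('a list \<Rightarrow> 'k::comm_ring_1) \<Rightarrow> 'a list \<Rightarrow> 'k" where
  "diff P c [] = (\<Sum>v\<in>P. c [v])"
| "diff P c (y # ys) = (\<Sum>v\<in>P. c (v # y # ys)) - diff P (\<lambda>zs. c (y # zs)) ys"

lemma diff_linear: "diff P (\<lambda>zs. a * c zs + b * e zs) ys = a * diff P c ys + b * diff P e ys"
proof (induction ys arbitrary: c e)
  case Nil
  show ?case by (simp add: sum.distrib sum_distrib_left)
next
  case (Cons y ys)
  show ?case using Cons.IH[of "\<lambda>zs. c (y # zs)" "\<lambda>zs. e (y # zs)"]
    by (simp add: sum.distrib sum_distrib_left algebra_simps)
qed

lemma diff_zero [simp]: "diff P (\<lambda>_. 0) ys = 0"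
  by (induction ys) auto

lemma diff_add: "diff P (\<lambda>zs. c zs + e zs) ys = diff P c ys + diff P e ys"
  using diff_linear[of P 1 c 1 e ys] by simp

lemma diff_minus: "diff P (\<lambda>zs. c zs - e zs) ys = diff P c ys - diff P e ys"
  using diff_linear[of P 1 c "-1" e ys] by simp

lemma diff_scale: "diff P (\<lambda>zs. a * c zs) ys = a * diff P c ys"
  using diff_linear[of P a c 0 c ys] by simp

lemma diff_sum: "diff P (\<lambda>zs. \<Sum>v\<in>V. c v zs) ys = (\<Sum>v\<in>V. diff P (c v) ys)"
  by (induction V rule: infinite_finite_induct) (auto simp: diff_add)

text \<open>Two elements inserted into the same gap can arrive in either order; the resulting lists
  agree and the signs are opposite, so the double sums cancel after \<open>sum.swap\<close>. The
  remaining terms form the same expression for the tail.\<close>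

lemma diff_diff: "diff P (diff P c) ys = 0"
proof (induction ys arbitrary: c)
  case Nil
  have "(\<Sum>v\<in>P. \<Sum>w\<in>P. c [v, w]) = (\<Sum>v\<in>P. \<Sum>w\<in>P. c [w, v])"
    by (rule sum.swap)
  then show ?case by (simp add: sum_subtractf)
next
  case (Cons y ys)
  have sw: "(\<Sum>v\<in>P. \<Sum>w\<in>P. c (v # w # y # ys)) = (\<Sum>v\<in>P. \<Sum>w\<in>P. c (w # v # y # ys))"
    by (rule sum.swap)
  have "diff P (diff P c) (y # ys) = (\<Sum>v\<in>P. diff P (\<lambda>zs. c (v # y # zs)) ys)
      - diff P (\<lambda>zs. (\<Sum>v\<in>P. c (v # y # zs)) - diff P (\<lambda>ws. c (y # ws)) zs) ys"
    using sw by (simp add: sum_subtractf sum.distrib)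
  also have "\<dots> = diff P (diff P (\<lambda>ws. c (y # ws))) ys"
    by (simp add: diff_minus diff_sum)
  finally show ?case using Cons.IH by simp
qed

text \<open>This is the simplicial boundary read on coefficients: the value at \<open>ys\<close>
  collects all lists from which \<open>ys\<close> arises by deleting position \<open>j\<close>. The
  recursive form suits inductions on the head, the closed form suits support arguments and the
  comparison with \<open>bdry\<close>.\<close>

lemma diff_insert:
  "diff P c ys = (\<Sum>j\<le>length ys. (-1) ^ j * (\<Sum>v\<in>P. c (take j ys @ v # drop j ys)))"
proof (induction ys arbitrary: c)
  case Nil
  show ?case by simp
next
  case (Cons y ys)
  show ?case
    by (simp add: Cons.IH sum.atMost_Suc_shift sum_negf del: sum.atMost_Suc)
qed

section \<open>Acyclicity of open intervals in a graded lower semimodular poset\<close>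

locale lower_semimodular =
  fixes P :: "'a set" and le :: "'a \<Rightarrow> 'a \<Rightarrow> bool" and rk :: "'a \<Rightarrow> nat"
  assumes finite_P: "finite P"
    and le_refl: "x \<in> P \<Longrightarrow> le x x"
    and le_trans: "\<lbrakk>x \<in> P; y \<in> P; z \<in> P; le x y; le y z\<rbrakk> \<Longrightarrow> le x z"
    and rk_less: "\<lbrakk>x \<in> P; y \<in> P; le x y; x \<noteq> y\<rbrakk> \<Longrightarrow> rk x < rk y"
    and coatom_above: "\<lbrakk>x \<in> P; y \<in> P; le x y; x \<noteq> y\<rbrakk>
          \<Longrightarrow> \<exists>a\<in>P. le x a \<and> le a y \<and> rk y = Suc (rk a)"
    and semimodular: "\<lbrakk>x \<in> P; y \<in> P; a \<in> P; b \<in> P; le x a; le x b; a \<noteq> b;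
          le a y; rk y = Suc (rk a); le b y; rk y = Suc (rk b)\<rbrakk>
          \<Longrightarrow> \<exists>c\<in>P. le x c \<and> le c a \<and> rk a = Suc (rk c) \<and> le c b"
begin

text \<open>The index \<open>m\<close> counts vertices, so the empty chain is the generator in index
  0 and the complex is augmented.\<close>

definition desc :: "'a set \<Rightarrow> nat \<Rightarrow> 'a list set" where
  "desc V m = {zs. length zs = m \<and> set zs \<subseteq> V \<and> sorted_wrt (\<lambda>a b. le b a \<and> b \<noteq> a) zs}"

definition chains :: "'a set \<Rightarrow> nat \<Rightarrow> ('a list \<Rightarrow> 'k::comm_ring_1) set" where
  "chains V m = {c. \<forall>zs. zs \<notin> desc V m \<longrightarrow> c zs = 0}"

lemma desc_mono: "V \<subseteq> W \<Longrightarrow> desc V m \<subseteq> desc W m"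
  by (auto simp: desc_def)

lemma chains_mono: "V \<subseteq> W \<Longrightarrow> chains V m \<subseteq> chains W m"
  unfolding chains_def using desc_mono by blast

lemma diff_chains:
  assumes "c \<in> chains V (Suc m)"
  shows "diff P c \<in> chains V m"
proof -
  have "c (take j ys @ v # drop j ys) = 0" if "ys \<notin> desc V m" for ys j v
  proof -
    have "set (take j ys) \<union> set (drop j ys) = set ys"
      by (metis append_take_drop_id set_append)
    moreover have "sorted_wrt (\<lambda>a b. le b a \<and> b \<noteq> a) ys"
      if "sorted_wrt (\<lambda>a b. le b a \<and> b \<noteq> a) (take j ys @ v # drop j ys)"
    proof -
      have "sorted_wrt (\<lambda>a b. le b a \<and> b \<noteq> a) (take j ys @ drop j ys)"
        using that unfolding sorted_wrt_append by auto
      then show ?thesis by simp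
    qed
    ultimately have "take j ys @ v # drop j ys \<notin> desc V (Suc m)"
      using that by (auto simp: desc_def)
    then show ?thesis using assms by (simp add: chains_def)
  qed
  then show ?thesis by (simp add: chains_def diff_insert)
qed

lemma diff_chains_0:
  assumes "c \<in> chains V 0"
  shows "diff P c ys = 0"
proof -
  have "c (take j ys @ v # drop j ys) = 0" for j v
    using assms by (simp add: chains_def desc_def)
  then show ?thesis by (simp add: diff_insert)
qed

text \<open>Prefixing the apex \<open>a\<close> is a contracting homotopy: \<open>a\<close> lies
  above all of \<open>V\<close>, so it can head every descending chain that avoids it, and insertion
  at the head carries the sign +1.\<close>

lemma cone_acyclic:
  fixes z :: "'a list \<Rightarrow> 'k::comm_ring_1"
  assumes V: "V \<subseteq> P" "a \<in> V" "\<And>v. v \<in> V \<Longrightarrow> le v a"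
    and z: "z \<in> chains V m" "\<And>ys. diff P z ys = 0"
  shows "\<exists>w\<in>chains V (Suc m). \<forall>ys. diff P w ys = z ys"
proof -
  define w :: "'a list \<Rightarrow> 'k" where
    "w zs = (case zs of [] \<Rightarrow> 0 | b # xs \<Rightarrow> if b = a \<and> a \<notin> set xs then z xs else 0)" for zs
  have z0: "z zs = 0" if "zs \<notin> desc V m" for zs
    using z(1) that by (simp add: chains_def)
  have wc: "w \<in> chains V (Suc m)"
    unfolding chains_def mem_Collect_eq
  proof (intro allI impI)
    fix zs assume n: "zs \<notin> desc V (Suc m)"
    show "w zs = 0"
    proof (cases zs)
      case (Cons b xs)
      have "xs \<notin> desc V m" if "b = a" "a \<notin> set xs"
        using n that V by (auto simp: desc_def Cons)
      then show ?thesis using z0 by (auto simp: w_def Cons)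
    qed (simp add: w_def)
  qed
  have aP: "a \<in> P" using V by auto
  have hd_only: "(\<Sum>v\<in>P. w (v # xs)) = (if a \<in> set xs then 0 else z xs)" for xs
    using finite_P aP by (simp add: w_def sum.If_cases if_distrib cong: if_cong)
  \<comment> \<open>The apex can occur in a descending chain only as its head: further down it would
    be comparable with the head in both directions, against strict monotonicity of
    \<open>rk\<close>.\<close>
  have nosnd: "a \<notin> set xs" if "zs \<in> desc V m" "zs = b # xs" for zs b xs
  proof
    assume "a \<in> set xs"
    then have b: "le a b" "a \<noteq> b" "b \<in> V" using that by (auto simp: desc_def)
    then have "le b a" using V by auto
    then have "rk b < rk a" "rk a < rk b" using rk_less b V aP by blast+
    then show False by simp
  qed
  have "diff P w ys = z ys" if ys: "ys \<in> desc V m" for ys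
  proof (cases ys)
    case Nil
    then show ?thesis using hd_only[of "[]"] by simp
  next
    case (Cons y xs)
    have a: "a \<notin> set xs" using nosnd ys Cons by blast
    show ?thesis
    proof (cases "y = a")
      case False
      have "(\<lambda>zs. w (y # zs)) = (\<lambda>_. 0)" using False by (auto simp: w_def)
      then show ?thesis using False a hd_only[of ys] by (simp add: Cons)
    next
      case True
      \<comment> \<open>\<open>z'\<close> is the part of \<open>z\<close> on chains headed by the
        apex. Over \<open>a # xs\<close> no new apex can be inserted, so only the tail term
        \<open>- diff P (z - z') xs\<close> survives; as \<open>z\<close> is a cycle this is
        \<open>diff P z' xs\<close>, to which again only the head insertion contributes.\<close>
      define z' where "z' zs = (if zs \<noteq> [] \<and> hd zs = a then z zs else 0)" for zs
      have "w (a # zs) = z zs - z' zs" for zs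
      proof (cases "zs \<in> desc V m")
        case True
        then show ?thesis using nosnd[OF True] by (cases zs) (auto simp: w_def z'_def)
      next
        case False
        then show ?thesis using z0 by (auto simp: w_def z'_def)
      qed
      then have "diff P (\<lambda>zs. w (a # zs)) xs = - diff P z' xs"
        using z(2) by (simp add: diff_minus)
      also have "diff P z' xs = z (a # xs)"
      proof -
        have 1: "(\<Sum>v\<in>P. z' (v # us)) = z (a # us)" for us
          using finite_P aP by (simp add: z'_def sum.If_cases if_distrib cong: if_cong)
        show ?thesis
        proof (cases xs)
          case Nil
          then show ?thesis using 1[of "[]"] by simp
        next
          case (Cons u us)
          then have "(\<lambda>zs. z' (u # zs)) = (\<lambda>_. 0)" using a by (auto simp: z'_def)
          then show ?thesis using 1[of xs] by (simp add: Cons)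
        qed
      qed
      finally show ?thesis using hd_only[of ys] True by (simp add: Cons)
    qed
  qed
  moreover have "diff P w ys = z ys" if "ys \<notin> desc V m" for ys
    using diff_chains[OF wc] z0 that by (simp add: chains_def)
  ultimately show ?thesis using wc by blast
qed

definition below :: "'a \<Rightarrow> 'a set \<Rightarrow> 'a set" where
  "below x S = {v \<in> P. le x v \<and> x \<noteq> v \<and> (\<exists>s\<in>S. le v s)}"

text \<open>Chains in \<open>below x S\<close> have at most \<open>r - 1\<close> vertices, so
  \<open>Suc m < r\<close> places \<open>m\<close> below the top. Mayer-Vietoris is carried out on
  chains: \<open>z\<close> splits as \<open>z1 + z2\<close>, the boundary shared up to sign is
  filled by some \<open>w\<close> in the intersection, and \<open>z1 - w\<close>,
  \<open>z2 + w\<close> are cycles in the two pieces. The outer induction on \<open>r\<close> fills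
  the intersection, the inner one on \<open>S\<close> fills the first piece.\<close>

lemma below_acyclic:
  fixes z :: "'a list \<Rightarrow> 'k::comm_ring_1"
  assumes "x \<in> P" "y \<in> P" "rk y = rk x + r" "Suc m < r"
    and "S \<noteq> {}" "S \<subseteq> {a \<in> P. le x a \<and> le a y \<and> rk y = Suc (rk a)}"
    and "z \<in> chains (below x S) m" "\<And>ys. diff P z ys = 0"
  shows "\<exists>w\<in>chains (below x S) (Suc m). \<forall>ys. diff P w ys = z ys"
  using assms(2-)
proof (induction r arbitrary: y S m z)
  case 0
  then show ?case by simp
next
  case (Suc r)
  have "finite S" using Suc.prems finite_P by (auto intro: finite_subset)
  then show ?case using Suc.prems(4-7)
  proof (induction S arbitrary: z rule: finite_ne_induct)
    case (singleton a)
    then have a: "a \<in> P" "le x a" "le a y" "rk y = Suc (rk a)" by auto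
    then have "x \<noteq> a" using Suc.prems by auto
    then show ?case
      using a singleton.prems le_refl by (intro cone_acyclic[of _ a]) (auto simp: below_def)
  next
    case (insert a S)
    have a: "a \<in> P" "le x a" "le a y" "rk y = Suc (rk a)"
      and S: "S \<subseteq> {a \<in> P. le x a \<and> le a y \<and> rk y = Suc (rk a)}"
      using insert.prems by auto
    define z1 where "z1 zs = (if zs \<in> desc (below x S) m then z zs else 0)" for zs
    define z2 where "z2 zs = z zs - z1 zs" for zs
    define T where "T = {c \<in> P. le x c \<and> le c a \<and> rk a = Suc (rk c) \<and> (\<exists>b\<in>S. le c b)}"
    have z: "z zs = 0" if "zs \<notin> desc (below x (insert a S)) m" for zs
      using insert.prems that by (simp add: chains_def)
    have z1: "z1 \<in> chains (below x S) m" by (auto simp: z1_def chains_def)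
    have z2: "z2 \<in> chains (below x {a}) m"
      unfolding chains_def mem_Collect_eq
    proof (intro allI impI, rule ccontr)
      fix zs assume n: "zs \<notin> desc (below x {a}) m" and "z2 zs \<noteq> 0"
      then have *: "zs \<notin> desc (below x S) m" "zs \<in> desc (below x (insert a S)) m"
        using z[of zs] by (auto simp: z2_def z1_def split: if_splits)
      then obtain u us where zs: "zs = u # us" by (cases zs) (auto simp: desc_def)
      have u: "u \<in> below x (insert a S)" using * zs by (auto simp: desc_def)
      have us: "v \<in> P \<and> le x v \<and> x \<noteq> v \<and> le v u" if "v \<in> set zs" for v
        using that * zs le_refl by (auto simp: desc_def below_def)
      \<comment> \<open>A chain lies below everything its head lies below. Thus each chain of the
        union lies entirely in one piece, and those not already in the old piece lie in the cone
        under \<open>a\<close>.\<close>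
      have "v \<in> below x {s}" if "v \<in> set zs" "le u s" "s \<in> insert a S" for v s
        using us[OF that(1)] u that le_trans[of v u s] a S
        by (auto simp: below_def)
      then have "set zs \<subseteq> below x {s}" if "le u s" "s \<in> insert a S" for s
        using that by blast
      then have sub: "zs \<in> desc (below x {s}) m" if "le u s" "s \<in> insert a S" for s
        using that * by (auto simp: desc_def)
      obtain s where s: "s \<in> insert a S" "le u s" using u by (auto simp: below_def)
      then have "s \<in> S" using sub n by auto
      then have "below x {s} \<subseteq> below x S" by (auto simp: below_def)
      then show False using sub s * desc_mono by blast
    qed
    \<comment> \<open>Semimodularity is applied above \<open>v\<close> instead of \<open>x\<close>:
      it turns a common lower bound \<open>v\<close> of \<open>a\<close> and some \<open>b\<close>
      in \<open>S\<close> into an element of \<open>T\<close> still above \<open>v\<close>.\<close>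
    have VT: "below x S \<inter> below x {a} = below x T"
    proof (intro set_eqI iffI)
      fix v assume "v \<in> below x S \<inter> below x {a}"
      then obtain b where v: "v \<in> P" "le x v" "x \<noteq> v" "b \<in> S" "le v b" "le v a"
        by (auto simp: below_def)
      then obtain c where c: "c \<in> P" "le v c" "le c a" "rk a = Suc (rk c)" "le c b"
        using semimodular[of v y a b] a S Suc.prems(1) insert.hyps by blast
      then have "le x c" using le_trans[of x v c] v assms(1) by blast
      then show "v \<in> below x T" using v c by (auto simp: below_def T_def)
    next
      fix v assume "v \<in> below x T"
      then obtain c b where v: "v \<in> P" "le x v" "x \<noteq> v" "le v c"
        and c: "c \<in> P" "le c a" "b \<in> S" "le c b"
        by (auto simp: below_def T_def)
      then have "le v a" "le v b" using le_trans[of v c] a S by auto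
      then show "v \<in> below x S \<inter> below x {a}" using v c by (auto simp: below_def)
    qed
    \<comment> \<open>The induction hypothesis asks for a nonempty set of coatoms; here
      semimodularity is applied above \<open>x\<close> itself.\<close>
    have T: "T \<noteq> {}"
    proof -
      obtain b where "b \<in> S" using insert.hyps by auto
      then show ?thesis
        using semimodular[of x y a b] a S Suc.prems(1) insert.hyps assms(1)
        by (force simp: T_def)
    qed
    have d12: "diff P z1 ys = - diff P z2 ys" for ys
    proof -
      have "z = (\<lambda>zs. z1 zs + z2 zs)" by (auto simp: z2_def)
      then have "diff P z1 ys + diff P z2 ys = 0"
        using insert.prems(3)[of ys] diff_add[of P z1 z2] by simp
      then show ?thesis by (simp add: eq_neg_iff_add_eq_0)
    qed
    \<comment> \<open>Being also minus the boundary of \<open>z2\<close>, the boundary of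
      \<open>z1\<close> is supported in both pieces, hence in their intersection. It has one vertex
      fewer, matching the interval from \<open>x\<close> to \<open>a\<close>, which is shorter by
      one.\<close>
    have "\<exists>w\<in>chains (below x T) m. \<forall>ys. diff P w ys = diff P z1 ys"
    proof (cases m)
      case 0
      then have "diff P z1 ys = 0" for ys using z1 diff_chains_0 by blast
      then show ?thesis by (intro bexI[of _ "\<lambda>_. 0"]) (auto simp: chains_def)
    next
      case (Suc m')
      have c1: "diff P z1 \<in> chains (below x S) m'"
        using z1 diff_chains Suc by blast
      have c2: "diff P z2 \<in> chains (below x {a}) m'"
        using z2 diff_chains Suc by blast
      have "diff P z1 \<in> chains (below x T) m'"
        unfolding chains_def mem_Collect_eq
      proof (intro allI impI)
        fix ys assume "ys \<notin> desc (below x T) m'"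
        then have "ys \<notin> desc (below x S) m' \<or> ys \<notin> desc (below x {a}) m'"
          using VT by (auto simp: desc_def)
        then show "diff P z1 ys = 0"
          using c1 c2 d12[of ys] by (auto simp: chains_def)
      qed
      moreover have "rk a = rk x + r" using a Suc.prems by simp
      moreover have "Suc m' < r" using Suc Suc.prems by simp
      moreover have "T \<subseteq> {c \<in> P. le x c \<and> le c a \<and> rk a = Suc (rk c)}" by (auto simp: T_def)
      ultimately show ?thesis
        using Suc.IH[of a m' T "diff P z1"] a T diff_diff Suc by blast
    qed
    then obtain w where w: "w \<in> chains (below x T) m" "\<And>ys. diff P w ys = diff P z1 ys"
      by blast
    have wS: "w \<in> chains (below x S) m" and wa: "w \<in> chains (below x {a}) m"
      using w(1) VT chains_mono[of "below x T"] by blast+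
    have "(\<lambda>zs. z1 zs - w zs) \<in> chains (below x S) m"
      using z1 wS by (auto simp: chains_def)
    moreover have "diff P (\<lambda>zs. z1 zs - w zs) ys = 0" for ys
      using w(2) by (simp add: diff_minus)
    ultimately obtain w1 where w1: "w1 \<in> chains (below x S) (Suc m)"
      "\<And>ys. diff P w1 ys = z1 ys - w ys"
      using insert.IH[of "\<lambda>zs. z1 zs - w zs"] insert.prems S by blast
    have "(\<lambda>zs. z2 zs + w zs) \<in> chains (below x {a}) m"
      using z2 wa by (auto simp: chains_def)
    moreover have "diff P (\<lambda>zs. z2 zs + w zs) ys = 0" for ys
      using w(2) d12 by (simp add: diff_add)
    moreover have cone_a: "below x {a} \<subseteq> P" "a \<in> below x {a}" "\<And>v. v \<in> below x {a} \<Longrightarrow> le v a"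
      using a Suc.prems le_refl by (auto simp: below_def)
    ultimately obtain w2 where w2: "w2 \<in> chains (below x {a}) (Suc m)"
      "\<And>ys. diff P w2 ys = z2 ys + w ys"
      using cone_acyclic[OF cone_a, of "\<lambda>zs. z2 zs + w zs" m] by blast
    have "below x S \<subseteq> below x (insert a S)" "below x {a} \<subseteq> below x (insert a S)"
      by (auto simp: below_def)
    then have "w1 \<in> chains (below x (insert a S)) (Suc m)"
      "w2 \<in> chains (below x (insert a S)) (Suc m)"
      using w1 w2 chains_mono by blast+
    then have "(\<lambda>zs. w1 zs + w2 zs) \<in> chains (below x (insert a S)) (Suc m)"
      by (auto simp: chains_def)
    moreover have "diff P (\<lambda>zs. w1 zs + w2 zs) ys = z ys" for ys
      using w1 w2 by (simp add: diff_add z2_def)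
    ultimately show ?case by blast
  qed
qed

text \<open>Every element of the open interval lies under a coatom of \<open>y\<close>, so the
  interval is \<open>below x S\<close> with \<open>S\<close> the set of all coatoms above
  \<open>x\<close>.\<close>

lemma open_interval_acyclic:
  fixes z :: "'a list \<Rightarrow> 'k::comm_ring_1"
  defines "V \<equiv> \<lambda>x y. {v \<in> P. le x v \<and> x \<noteq> v \<and> le v y \<and> v \<noteq> y}"
  assumes xy: "x \<in> P" "y \<in> P" "le x y" "Suc m < rk y - rk x"
    and "z \<in> chains (V x y) m" "\<And>ys. diff P z ys = 0"
  shows "\<exists>w\<in>chains (V x y) (Suc m). \<forall>ys. diff P w ys = z ys"
proof -
  define S where "S = {a \<in> P. le x a \<and> le a y \<and> rk y = Suc (rk a)}"
  have "V x y = below x S"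
  proof (intro set_eqI iffI)
    fix v assume v: "v \<in> V x y"
    then obtain a where "a \<in> P" "le v a" "le a y" "rk y = Suc (rk a)"
      using coatom_above[of v y] xy by (auto simp: V_def)
    moreover from this have "le x a" using le_trans[of x v a] v xy by (auto simp: V_def)
    ultimately show "v \<in> below x S" using v by (auto simp: V_def below_def S_def)
  next
    fix v assume "v \<in> below x S"
    then obtain s where v: "v \<in> P" "le x v" "x \<noteq> v" "s \<in> P" "le v s" "le s y" "rk y = Suc (rk s)"
      by (auto simp: below_def S_def)
    then have "v \<noteq> y" using rk_less[of v s] by fastforce
    moreover have "le v y" using v le_trans[of v s y] xy by blast
    ultimately show "v \<in> V x y" using v by (auto simp: V_def)
  qed
  moreover have "S \<noteq> {}"
    using coatom_above[of x y] xy by (fastforce simp: S_def)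
  moreover have "rk y = rk x + (rk y - rk x)" using xy by simp
  ultimately show ?thesis
    using below_acyclic[of x y "rk y - rk x" m S z] xy assms(6-)
    by (simp add: S_def)
qed

end

subsection \<open>Merging two blocks of a pointed partition\<close>

lemma pparts_iff:
  "y \<in> pparts n \<longleftrightarrow> (\<forall>A p. (A, p) \<in> y \<longrightarrow> A \<noteq> {} \<and> p \<in> A) \<and>
     (\<forall>A p B q. (A, p) \<in> y \<longrightarrow> (B, q) \<in> y \<longrightarrow> (A = B \<longrightarrow> p \<noteq> q) \<longrightarrow> A \<inter> B = {}) \<and>
     \<Union> (fst ` y) = {1..n}"
  by (simp add: pparts_def pointed_partition_def Ball_def)

lemma pparts_pointD: "\<lbrakk>y \<in> pparts n; (A, p) \<in> y\<rbrakk> \<Longrightarrow> p \<in> A"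
  by (simp add: pparts_iff)

lemma pparts_subsetD: "\<lbrakk>y \<in> pparts n; (A, p) \<in> y\<rbrakk> \<Longrightarrow> A \<subseteq> {1..n}"
  unfolding pparts_iff by force

lemma pparts_unique:
  "\<lbrakk>y \<in> pparts n; (A, p) \<in> y; (B, q) \<in> y; i \<in> A; i \<in> B\<rbrakk> \<Longrightarrow> A = B \<and> p = q"
  unfolding pparts_iff by blast

lemma pparts_block: "\<lbrakk>y \<in> pparts n; i \<in> {1..n}\<rbrakk> \<Longrightarrow> \<exists>A p. (A, p) \<in> y \<and> i \<in> A"
proof -
  assume "y \<in> pparts n" "i \<in> {1..n}"
  then have "i \<in> \<Union> (fst ` y)" by (simp add: pparts_iff)
  then show ?thesis by force
qed

lemma pparts_same_point: "\<lbrakk>y \<in> pparts n; (A, p) \<in> y; (B, p) \<in> y\<rbrakk> \<Longrightarrow> A = B"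
  using pparts_unique pparts_pointD by blast

lemma ppartsI:
  assumes "\<And>A p. (A, p) \<in> y \<Longrightarrow> p \<in> A \<and> A \<subseteq> {1..n}"
    and "\<And>A p B q i. \<lbrakk>(A, p) \<in> y; (B, q) \<in> y; i \<in> A; i \<in> B\<rbrakk> \<Longrightarrow> A = B \<and> p = q"
    and "\<And>i. i \<in> {1..n} \<Longrightarrow> \<exists>A p. (A, p) \<in> y \<and> i \<in> A"
  shows "y \<in> pparts n"
proof -
  have "\<Union> (fst ` y) = {1..n}"
  proof
    show "\<Union> (fst ` y) \<subseteq> {1..n}" using assms(1) by force
    show "{1..n} \<subseteq> \<Union> (fst ` y)"
    proof
      fix i assume "i \<in> {1..n}"
      then obtain A p where "(A, p) \<in> y" "i \<in> A" using assms(3) by blast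
      then show "i \<in> \<Union> (fst ` y)" by force
    qed
  qed
  moreover have "A \<inter> B = {}" if "(A, p) \<in> y" "(B, q) \<in> y" "(A, p) \<noteq> (B, q)" for A p B q
    using that assms(2) by blast
  moreover have "A \<noteq> {} \<and> p \<in> A" if "(A, p) \<in> y" for A p using that assms(1) by blast
  ultimately show ?thesis
    unfolding pparts_iff by blast
qed

lemma finite_pparts [simp]: "finite (pparts n)"
proof (rule finite_subset)
  show "pparts n \<subseteq> Pow (Pow {1..n} \<times> {1..n})"
    using pparts_pointD pparts_subsetD by fastforce
qed auto

lemma pparts_finite: "y \<in> pparts n \<Longrightarrow> finite y"
  by (rule finite_subset[of _ "Pow {1..n} \<times> {1..n}"])
    (use pparts_pointD pparts_subsetD in fastforce)+

lemma card_points: "y \<in> pparts n \<Longrightarrow> card (snd ` y) = card y"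
  by (rule card_image) (use pparts_same_point in \<open>fastforce simp: inj_on_def\<close>)

lemma pp_max_pparts [simp]: "pp_max n \<in> pparts n"
proof (rule ppartsI)
  show "\<exists>A p. (A, p) \<in> pp_max n \<and> i \<in> A" if "i \<in> {1..n}" for i
    using that by (intro exI[of _ "{i}"] exI[of _ i]) (simp add: pp_max_def)
qed (auto simp: pp_max_def)

lemma snd_pp_max [simp]: "snd ` pp_max n = {1..n}"
  by (force simp: pp_max_def)

lemma card_pp_max [simp]: "card (pp_max n) = n"
  using card_points[of "pp_max n" n] by simp

lemma pp_leD:
  assumes "pp_le x y" "(C, q) \<in> y"
  shows "\<exists>B b. (B, b) \<in> x \<and> C \<subseteq> B"
  using assms unfolding pp_le_def by fastforce

lemma pp_le_block:
  assumes "x \<in> pparts n" "y \<in> pparts n" "pp_le x y" "(C, q) \<in> y" "(B, b) \<in> x" "i \<in> C" "i \<in> B"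
  shows "C \<subseteq> B"
  using pp_leD[OF assms(3,4)] pparts_unique[OF assms(1,5)] assms by blast

lemma pp_leI:
  assumes "\<And>C q. (C, q) \<in> y \<Longrightarrow> \<exists>B b. (B, b) \<in> x \<and> C \<subseteq> B"
    and "\<And>B b. (B, b) \<in> x \<Longrightarrow> \<exists>C. (C, b) \<in> y"
  shows "pp_le x y"
  unfolding pp_le_def
proof
  show "\<forall>C\<in>fst ` y. \<exists>B\<in>fst ` x. C \<subseteq> B"
  proof
    fix C assume "C \<in> fst ` y"
    then obtain q where "(C, q) \<in> y" by force
    then show "\<exists>B\<in>fst ` x. C \<subseteq> B" using assms(1) by force
  qed
  show "snd ` x \<subseteq> snd ` y" using assms(2) by force
qed

lemma pp_le_snd: "pp_le x y \<Longrightarrow> snd ` x \<subseteq> snd ` y"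
  by (simp add: pp_le_def)

lemma pp_le_point:
  assumes "pp_le x y" "(B, b) \<in> x"
  shows "\<exists>C. (C, b) \<in> y"
  using assms pp_le_snd by fastforce

lemma pp_le_refl: "pp_le x x"
  by (auto simp: pp_le_def)

lemma pp_le_trans: "pp_le x y \<Longrightarrow> pp_le y z \<Longrightarrow> pp_le x z"
  unfolding pp_le_def by (meson order_trans)

text \<open>If \<open>y\<close> had no more blocks than \<open>x\<close>, both would have the same
  points. All blocks of \<open>y\<close> inside one block of \<open>x\<close> would then carry the
  point of that block, so there is just one and the partitions coincide. Antisymmetry of
  \<open>pp_le\<close> on \<open>pparts n\<close> is also obtained from here.\<close>

lemma pp_le_card:
  assumes x: "x \<in> pparts n" and y: "y \<in> pparts n" and le: "pp_le x y" and ne: "x \<noteq> y"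
  shows "card x < card y"
proof (rule ccontr)
  assume "\<not> card x < card y"
  then have pts: "snd ` x = snd ` y"
    using card_points[OF x] card_points[OF y] pp_le_snd[OF le] pparts_finite[OF y]
    by (intro card_subset_eq) (auto intro: card_mono dest: card_mono[rotated])
  have sub: "(B, b) \<in> y" if B: "(B, b) \<in> x" for B b
  proof -
    obtain C where C: "(C, b) \<in> y" using pp_le_point[OF le B] by blast
    have bC: "b \<in> C" "b \<in> B" using pparts_pointD x y B C by auto
    then have "C \<subseteq> B" using pp_le_block[OF x y le C B] by blast
    moreover have "i \<in> C" if i: "i \<in> B" for i
    proof -
      obtain D d where D: "(D, d) \<in> y" "i \<in> D"
        using pparts_block[OF y] pparts_subsetD[OF x B] i by blast
      have "D \<subseteq> B" using pp_le_block[OF x y le D(1) B D(2) i] .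
      then have "d \<in> B" using pparts_pointD[OF y D(1)] by blast
      have "d \<in> snd ` x" using D(1) pts by force
      then obtain E where "(E, d) \<in> x" by force
      then have "d = b" using pparts_unique[OF x _ B] pparts_pointD[OF x] \<open>d \<in> B\<close> by blast
      then show ?thesis using D C pparts_same_point[OF y] by blast
    qed
    ultimately show ?thesis using C by (metis subsetI subset_antisym)
  qed
  have "(C, q) \<in> x" if C: "(C, q) \<in> y" for C q
  proof -
    have "q \<in> snd ` x" using C pts by force
    then obtain B where B: "(B, q) \<in> x" by force
    then show ?thesis using sub[OF B] pparts_same_point[OF y C] by blast
  qed
  then have "x = y" using sub by auto
  then show False using ne by simp
qed

text \<open>The union makes \<open>blk\<close> total, with the empty set at numbers that are not
  points, so that \<open>blk_merge\<close> holds without side conditions.\<close>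

definition blk :: "ppart \<Rightarrow> nat \<Rightarrow> nat set" where
  "blk y p = \<Union> {A. (A, p) \<in> y}"

definition merge :: "ppart \<Rightarrow> nat \<Rightarrow> nat \<Rightarrow> ppart" where
  "merge y p q = insert (blk y p \<union> blk y q, p) {(A, r) \<in> y. r \<noteq> p \<and> r \<noteq> q}"

lemma points_iff: "d \<in> snd ` y \<longleftrightarrow> (\<exists>A. (A, d) \<in> y)"
  by force

lemma blk_eq: "y \<in> pparts n \<Longrightarrow> (A, p) \<in> y \<Longrightarrow> blk y p = A"
  unfolding blk_def using pparts_same_point by blast

lemma blk_in: "y \<in> pparts n \<Longrightarrow> p \<in> snd ` y \<Longrightarrow> (blk y p, p) \<in> y"
  using blk_eq by force

lemma merge_mem:
  "(D, d) \<in> merge y p q \<longleftrightarrow>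
     D = blk y p \<union> blk y q \<and> d = p \<or> (D, d) \<in> y \<and> d \<noteq> p \<and> d \<noteq> q"
  by (auto simp: merge_def)

context
  fixes n y p q
  assumes y: "y \<in> pparts n" and p: "p \<in> snd ` y" and q: "q \<in> snd ` y" and pq: "p \<noteq> q"
begin

lemma merge_pparts: "merge y p q \<in> pparts n"
proof (rule ppartsI)
  note bp = blk_in[OF y p] and bq = blk_in[OF y q]
  show "d \<in> D \<and> D \<subseteq> {1..n}" if "(D, d) \<in> merge y p q" for D d
    using that bp bq pparts_pointD[OF y] pparts_subsetD[OF y] unfolding merge_mem by blast
  show "D = E \<and> d = e"
    if "(D, d) \<in> merge y p q" "(E, e) \<in> merge y p q" "i \<in> D" "i \<in> E" for D d E e i
    using that bp bq pparts_unique[OF y] unfolding merge_mem by blast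
  show "\<exists>D d. (D, d) \<in> merge y p q \<and> i \<in> D" if "i \<in> {1..n}" for i
  proof -
    obtain A r where "(A, r) \<in> y" "i \<in> A" using pparts_block[OF y \<open>i \<in> {1..n}\<close>] by blast
    then show ?thesis using blk_eq[OF y] unfolding merge_mem by blast
  qed
qed

lemma snd_merge: "snd ` merge y p q = snd ` y - {q}"
proof -
  have "d \<in> snd ` merge y p q \<longleftrightarrow> d \<in> snd ` y - {q}" for d
    using p pq unfolding Diff_iff points_iff merge_mem by blast
  then show ?thesis by blast
qed

lemma card_merge: "card y = Suc (card (merge y p q))"
proof -
  have "card (snd ` y) = Suc (card (snd ` y - {q}))"
    using q pparts_finite[OF y] by (metis card_Suc_Diff1 finite_imageI)
  then show ?thesis
    using card_points[OF y] card_points[OF merge_pparts] snd_merge by simp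
qed

lemma merge_le: "pp_le (merge y p q) y"
proof (rule pp_leI)
  show "\<exists>B b. (B, b) \<in> merge y p q \<and> C \<subseteq> B" if "(C, r) \<in> y" for C r
    using that blk_eq[OF y that] unfolding merge_mem by blast
  show "\<exists>C. (C, b) \<in> y" if "(B, b) \<in> merge y p q" for B b
    using that p unfolding merge_mem by force
qed

text \<open>A block of \<open>x\<close> containing \<open>p\<close> and \<open>q\<close> contains
  both merged blocks, and \<open>q\<close> is the only point lost. Comparison with a merge thus
  becomes a condition on a single block of \<open>x\<close>; semimodularity and the intervals of
  length two are both computed with it.\<close>

lemma le_merge_iff:
  assumes x: "x \<in> pparts n"
  shows "pp_le x (merge y p q) \<longleftrightarrow>
    pp_le x y \<and> (\<exists>D d. (D, d) \<in> x \<and> p \<in> D \<and> q \<in> D \<and> d \<noteq> q)"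
proof
  assume le: "pp_le x (merge y p q)"
  have "(blk y p \<union> blk y q, p) \<in> merge y p q" by (simp add: merge_mem)
  then obtain D d where D: "(D, d) \<in> x" "blk y p \<union> blk y q \<subseteq> D"
    using pp_leD[OF le] by blast
  have "d \<in> snd ` merge y p q" using D pp_le_snd[OF le] by force
  then have "d \<noteq> q" using snd_merge by blast
  then show "pp_le x y \<and> (\<exists>D d. (D, d) \<in> x \<and> p \<in> D \<and> q \<in> D \<and> d \<noteq> q)"
    using D pp_le_trans[OF le merge_le] pparts_pointD[OF y] blk_in[OF y p] blk_in[OF y q] by blast
next
  assume "pp_le x y \<and> (\<exists>D d. (D, d) \<in> x \<and> p \<in> D \<and> q \<in> D \<and> d \<noteq> q)"
  then obtain D d where le: "pp_le x y" and D: "(D, d) \<in> x" "p \<in> D" "q \<in> D" "d \<noteq> q" by blast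
  have "blk y p \<subseteq> D" "blk y q \<subseteq> D"
    using pp_le_block[OF x y le] D blk_in[OF y p] blk_in[OF y q] pparts_pointD[OF y] by blast+
  show "pp_le x (merge y p q)"
  proof (rule pp_leI)
    show "\<exists>B b. (B, b) \<in> x \<and> C \<subseteq> B" if "(C, r) \<in> merge y p q" for C r
      using that \<open>blk y p \<subseteq> D\<close> \<open>blk y q \<subseteq> D\<close> D(1) pp_leD[OF le] unfolding merge_mem by blast
    show "\<exists>C. (C, b) \<in> merge y p q" if B: "(B, b) \<in> x" for B b
    proof -
      obtain C where "(C, b) \<in> y" using pp_le_point[OF le B] by blast
      moreover have "b \<noteq> q"
        using pparts_unique[OF x D(1) B] pparts_pointD[OF x B] D by blast
      ultimately show ?thesis unfolding merge_mem by blast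
    qed
  qed
qed

end

text \<open>Absorbing a second point of \<open>y\<close> into the point of the block of
  \<open>x\<close> containing it stays above \<open>x\<close>. If no such merge exists, every point
  of \<open>y\<close> is a point of \<open>x\<close>, and the block counts contradict
  \<open>pp_le_card\<close>.\<close>

lemma le_merge_exists:
  assumes x: "x \<in> pparts n" and y: "y \<in> pparts n" and le: "pp_le x y" and ne: "x \<noteq> y"
  shows "\<exists>p q. p \<in> snd ` y \<and> q \<in> snd ` y \<and> p \<noteq> q \<and> pp_le x (merge y p q)"
proof (rule ccontr)
  assume neg: "\<not> ?thesis"
  have hit: "q = b" if B: "(B, b) \<in> x" and C: "(C, q) \<in> y" "q \<in> B" for B b C q
  proof (rule ccontr)
    assume ne: "q \<noteq> b"
    have b: "b \<in> snd ` y" and q: "q \<in> snd ` y" using B pp_le_snd[OF le] C by force+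
    have "b \<in> B" using pparts_pointD[OF x B] .
    then have "pp_le x (merge y b q)"
      using le_merge_iff[OF y b q ne[symmetric] x] le B C ne by blast
    then show False using neg b q ne[symmetric] by metis
  qed
  then have "snd ` y \<subseteq> snd ` x"
  proof -
    have "q \<in> snd ` x" if C: "(C, q) \<in> y" for C q
    proof -
      obtain B b where "(B, b) \<in> x" "C \<subseteq> B" using pp_leD[OF le C] by blast
      then have "(B, b) \<in> x" "q = b"
        using hit[OF _ C, of B b] pparts_pointD[OF y C] by auto
      then show ?thesis by force
    qed
    then show ?thesis by force
  qed
  then have "card y \<le> card x"
    using card_points[OF x] card_points[OF y] pparts_finite[OF x] card_mono
    by (metis finite_imageI)
  then show False using pp_le_card[OF x y le ne] by simp
qed

lemma covered_is_merge:
  assumes a: "a \<in> pparts n" and y: "y \<in> pparts n" and le: "pp_le a y" and c: "card y = Suc (card a)"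
  shows "\<exists>p q. p \<in> snd ` y \<and> q \<in> snd ` y \<and> p \<noteq> q \<and> a = merge y p q"
proof -
  obtain p q where pq: "p \<in> snd ` y" "q \<in> snd ` y" "p \<noteq> q" "pp_le a (merge y p q)"
    using le_merge_exists[OF a y le] c by (metis n_not_Suc_n)
  then have "a = merge y p q"
    using pp_le_card[OF a merge_pparts[OF y pq(1-3)] pq(4)] card_merge[OF y pq(1-3)] c by fastforce
  then show ?thesis using pq by blast
qed

text \<open>Merges of disjoint pairs can follow each other. Otherwise both happen inside one block
  of \<open>x\<close>, and the common lower element joins a third block to the first merge; the
  difficulty is to choose the surviving point so as to stay above \<open>x\<close> and below
  \<open>merge y r s\<close>.\<close>

lemma merge_semimodular:
  assumes x: "x \<in> pparts n" and y: "y \<in> pparts n"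
    and p: "p \<in> snd ` y" and q: "q \<in> snd ` y" and pq: "p \<noteq> q"
    and r: "r \<in> snd ` y" and s: "s \<in> snd ` y" and rs: "r \<noteq> s"
    and ne: "(p, q) \<noteq> (r, s)"
    and xa: "pp_le x (merge y p q)" and xb: "pp_le x (merge y r s)"
  shows "\<exists>u v. u \<in> snd ` merge y p q \<and> v \<in> snd ` merge y p q \<and> u \<noteq> v \<and>
    pp_le x (merge (merge y p q) u v) \<and> pp_le (merge (merge y p q) u v) (merge y r s)"
proof -
  let ?a = "merge y p q"
  note a = merge_pparts[OF y p q pq] and sa = snd_merge[OF y p q pq]
  obtain E e where E: "(E, e) \<in> x" "p \<in> E" "q \<in> E" "e \<noteq> q" and le: "pp_le x y"
    using xa le_merge_iff[OF y p q pq x] by blast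
  obtain F f where F: "(F, f) \<in> x" "r \<in> F" "s \<in> F" "f \<noteq> s"
    using xb le_merge_iff[OF y r s rs x] by blast
  \<comment> \<open>The extra merge must satisfy two conditions: the point \<open>v\<close> given up
    is not the point of its block in \<open>x\<close>, and some resulting block contains
    \<open>r\<close> and \<open>s\<close> without being pointed at \<open>s\<close>.\<close>
  have key: ?thesis
    if u: "u \<in> snd ` y" "u \<noteq> q" and v: "v \<in> snd ` y" "v \<noteq> q" and uv: "u \<noteq> v"
      and G: "(G, g) \<in> x" "u \<in> G" "v \<in> G" "g \<noteq> v"
      and H: "(H, h) \<in> merge ?a u v" "r \<in> H" "s \<in> H" "h \<noteq> s" for u v G g H h
  proof -
    have u': "u \<in> snd ` ?a" and v': "v \<in> snd ` ?a" using u v sa by auto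
    have "pp_le x (merge ?a u v)" using le_merge_iff[OF a u' v' uv x] xa G by blast
    moreover have "pp_le (merge ?a u v) (merge y r s)"
      using le_merge_iff[OF y r s rs merge_pparts[OF a u' v' uv]] H
        pp_le_trans[OF merge_le[OF a u' v' uv] merge_le[OF y p q pq]] by blast
    ultimately show ?thesis using u' v' uv by blast
  qed
  have pt: "t \<in> blk y t" if "t \<in> snd ` y" for t
    using blk_in[OF y that] pparts_pointD[OF y] by blast
  have bp: "blk ?a p = blk y p \<union> blk y q"
    by (rule blk_eq[OF a]) (simp add: merge_mem)
  have bt: "blk ?a t = blk y t" if "t \<in> snd ` y" "t \<noteq> p" "t \<noteq> q" for t
    by (rule blk_eq[OF a]) (use that blk_in[OF y that(1)] in \<open>simp add: merge_mem\<close>)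
  have top: "(blk ?a u \<union> blk ?a v, u) \<in> merge ?a u v" for u v by (simp add: merge_mem)
  show ?thesis
  proof (cases "{p, q} \<inter> {r, s} = {}")
    case True
    then show ?thesis
      using key[OF r _ s _ rs F top] bt[OF r] bt[OF s] pt[OF r] pt[OF s] rs by auto
  next
    case False
    then have EF: "F = E" "f = e" using pparts_unique[OF x E(1) F(1)] E F by auto
    txt \<open>A third block of \<open>y\<close> inside \<open>E\<close>, marked by \<open>z\<close>: the remaining one of \<open>r\<close>, \<open>s\<close>,
      or the one containing the point of \<open>E\<close> if both merges join the same pair of blocks.\<close>
    obtain z where z: "z \<in> snd ` y" "z \<noteq> p" "z \<noteq> q" "z \<in> E" "{r, s} \<subseteq> {p, q, z}"
      and zs: "z = e \<or> z = r \<or> z = s"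
    proof (cases "{r, s} = {p, q}")
      case True
      \<comment> \<open>The two merges keep opposite points of the same pair, so the point
        \<open>e\<close> of \<open>E\<close> is neither \<open>p\<close> nor \<open>q\<close> and
        marks a third block of \<open>y\<close>.\<close>
      then have "r = q" "s = p" using ne by (auto simp: doubleton_eq_iff)
      moreover have "e \<in> snd ` y" using E(1) pp_le_snd[OF le] by force
      ultimately show ?thesis
        using that[of e] E F EF pparts_pointD[OF x E(1)] by auto
    next
      case False
      then consider "r \<notin> {p, q}" "s \<in> {p, q}" | "s \<notin> {p, q}" "r \<in> {p, q}"
        using \<open>{p, q} \<inter> {r, s} \<noteq> {}\<close> rs by auto
      then show ?thesis
        using that[of r] that[of s] r s F EF by cases auto
    qed
    have covers: "r \<in> blk ?a p \<union> blk ?a z" "s \<in> blk ?a p \<union> blk ?a z"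
      using z pt[OF p] pt[OF q] pt[OF z(1)] bp bt[OF z(1)] by auto
    \<comment> \<open>The survivor must not be \<open>s\<close>, and the point given up must not be
      \<open>e\<close>. If \<open>p = s\<close> or \<open>z = e\<close>, keeping \<open>z\<close>
      meets both demands; otherwise keeping \<open>p\<close> does.\<close>
    show ?thesis
    proof (cases "p = s \<or> z = e")
      case True
      then have "z \<noteq> s" "p \<noteq> e" using z F EF by auto
      then show ?thesis
        using key[OF z(1,3) p pq z(2) E(1) z(4) E(2) _ top] covers by auto
    next
      case False
      then show ?thesis
        using key[OF p pq z(1,3) z(2)[symmetric] E(1) E(2) z(4) _ top] covers by auto
    qed
  qed
qed

text \<open>With the number of blocks as rank, the elements covered by \<open>y\<close> are its
  merges, so the axioms reduce to existence and exchange of merges.\<close>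

interpretation pp: lower_semimodular "pparts n" pp_le card for n
proof
  show "finite (pparts n)" by simp
  show "pp_le x x" for x by (rule pp_le_refl)
  show "pp_le x z" if "pp_le x y" "pp_le y z" for x y z using that by (rule pp_le_trans)
  show "card x < card y" if "x \<in> pparts n" "y \<in> pparts n" "pp_le x y" "x \<noteq> y" for x y
    using that by (rule pp_le_card)
  show "\<exists>a\<in>pparts n. pp_le x a \<and> pp_le a y \<and> card y = Suc (card a)"
    if "x \<in> pparts n" "y \<in> pparts n" "pp_le x y" "x \<noteq> y" for x y
    using le_merge_exists[OF that] merge_pparts[OF that(2)] merge_le[OF that(2)] card_merge[OF that(2)]
    by metis
  show "\<exists>c\<in>pparts n. pp_le x c \<and> pp_le c a \<and> card a = Suc (card c) \<and> pp_le c b"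
    if x: "x \<in> pparts n" and y: "y \<in> pparts n" and a: "a \<in> pparts n" and b: "b \<in> pparts n"
      and xa: "pp_le x a" and xb: "pp_le x b" and ne: "a \<noteq> b"
      and ay: "pp_le a y" "card y = Suc (card a)" and b_y: "pp_le b y" "card y = Suc (card b)"
    for x y a b
  proof -
    obtain p q where p: "p \<in> snd ` y" "q \<in> snd ` y" "p \<noteq> q" "a = merge y p q"
      using covered_is_merge[OF a y ay] by blast
    obtain r s where r: "r \<in> snd ` y" "s \<in> snd ` y" "r \<noteq> s" "b = merge y r s"
      using covered_is_merge[OF b y b_y] by blast
    have "(p, q) \<noteq> (r, s)" using ne p r by auto
    then obtain u v where u: "u \<in> snd ` a" "v \<in> snd ` a" "u \<noteq> v"
      "pp_le x (merge a u v)" "pp_le (merge a u v) b"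
      using merge_semimodular[OF x y p(1-3) r(1-3)] xa xb p(4) r(4) by blast
    then show ?thesis
      using merge_pparts[OF a u(1-3)] merge_le[OF a u(1-3)] card_merge[OF a u(1-3)] by blast
  qed
qed

subsection \<open>Homology below the top degree\<close>

lemma pp_less_trans:
  assumes "x \<in> pparts n" "y \<in> pparts n" "z \<in> pparts n" "pp_less x y" "pp_less y z"
  shows "pp_less x z"
proof -
  have "card x < card z"
    using assms pp_le_card[of x n y] pp_le_card[of y n z] by (auto simp: pp_less_def)
  then show ?thesis using assms pp_le_trans by (auto simp: pp_less_def)
qed

lemma pp_le_max: "x \<in> pparts n \<Longrightarrow> pp_le x (pp_max n)"
proof (rule pp_leI)
  assume x: "x \<in> pparts n"
  show "\<exists>B b. (B, b) \<in> x \<and> C \<subseteq> B" if "(C, q) \<in> pp_max n" for C q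
    using that pparts_block[OF x, of q] by (auto simp: pp_max_def)
  show "\<exists>C. (C, b) \<in> pp_max n" if B: "(B, b) \<in> x" for B b
    using pparts_subsetD[OF x B] pparts_pointD[OF x B] by (auto simp: pp_max_def)
qed

lemma pp_minimal_iff: "pp_minimal n x \<longleftrightarrow> x \<in> pparts n \<and> card x = 1"
  by (simp add: pp_minimal_def pparts_def)

lemma pchains_iff:
  "xs \<in> pchains n l \<longleftrightarrow> length xs = Suc l \<and> set xs \<subseteq> pparts n \<and> sorted_wrt pp_less xs \<and>
     pp_minimal n (hd xs) \<and> last xs = pp_max n"
proof -
  have "(\<forall>i<l. pp_less (xs ! i) (xs ! Suc i)) \<longleftrightarrow> sorted_wrt pp_less xs"
    if "length xs = Suc l" "set xs \<subseteq> pparts n"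
  proof -
    have "(\<forall>i<l. pp_less (xs ! i) (xs ! Suc i)) \<longleftrightarrow> successively pp_less xs"
      using that by (simp add: successively_conv_nth)
    also have "\<dots> \<longleftrightarrow> sorted_wrt pp_less xs"
      by (rule successively_iff_sorted_wrt_strong) (use that pp_less_trans in blast)
    finally show ?thesis .
  qed
  then show ?thesis unfolding pchains_def by auto
qed

lemma finite_pchains [simp]: "finite (pchains n l)"
  by (rule finite_subset[OF _ finite_lists_length_eq[of "pparts n" "Suc l"]])
    (auto simp: pchains_iff)

lemma sorted_card:
  "set xs \<subseteq> pparts n \<Longrightarrow> sorted_wrt pp_less xs \<Longrightarrow> sorted_wrt (<) (map card xs)"
  unfolding sorted_wrt_map
  by (rule sorted_wrt_mono_rel) (auto simp: pp_less_def intro: pp_le_card)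

text \<open>Chains with a prescribed \<open>i\<close>-th face \<open>y\<close> are the insertions
  into \<open>y\<close> at \<open>i\<close>. The inserted element may range over all of
  \<open>pparts n\<close> because \<open>c\<close> vanishes on lists that are not chains.\<close>

lemma bdry_insert:
  assumes c: "c \<in> chain_grp n l" and y: "length y = l"
  shows "bdry n l c y =
    (\<Sum>i\<in>{1..<l}. (-1) ^ i * (\<Sum>v\<in>pparts n. c (take i y @ v # drop i y)))"
proof -
  have *: "(\<Sum>x\<in>pchains n l. c x * (if del_at i x = y then (-1) ^ i else 0)) =
      (-1) ^ i * (\<Sum>v\<in>pparts n. c (take i y @ v # drop i y))" if i: "i \<in> {1..<l}" for i
  proof -
    let ?ins = "\<lambda>v. take i y @ v # drop i y"
    have "(\<Sum>x\<in>pchains n l. c x * (if del_at i x = y then (-1) ^ i else 0)) =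
        (\<Sum>x\<in>{x \<in> pchains n l. del_at i x = y}. c x * (-1) ^ i)"
      by (rule sum.mono_neutral_cong_right) auto
    also have "{x \<in> pchains n l. del_at i x = y} = ?ins ` {v \<in> pparts n. ?ins v \<in> pchains n l}"
    proof (intro set_eqI iffI)
      fix x assume "x \<in> {x \<in> pchains n l. del_at i x = y}"
      then have x: "x \<in> pchains n l" "take i x @ drop (Suc i) x = y"
        by (auto simp: del_at_def)
      then have l: "length x = Suc l" by (simp add: pchains_iff)
      have "x = ?ins (x ! i)"
        using l i x(2)[symmetric] id_take_nth_drop[of i x] by simp
      moreover have "x ! i \<in> pparts n" using x l i by (auto simp: pchains_iff)
      ultimately show "x \<in> ?ins ` {v \<in> pparts n. ?ins v \<in> pchains n l}" using x by auto
    next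
      fix x assume "x \<in> ?ins ` {v \<in> pparts n. ?ins v \<in> pchains n l}"
      then show "x \<in> {x \<in> pchains n l. del_at i x = y}"
        using i y by (auto simp: del_at_def)
    qed
    also have "(\<Sum>x\<in>?ins ` {v \<in> pparts n. ?ins v \<in> pchains n l}. c x * (-1) ^ i) =
        (\<Sum>v\<in>{v \<in> pparts n. ?ins v \<in> pchains n l}. c (?ins v) * (-1) ^ i)"
      by (subst sum.reindex) (auto simp: inj_on_def)
    also have "\<dots> = (\<Sum>v\<in>pparts n. c (?ins v) * (-1) ^ i)"
      by (rule sum.mono_neutral_left) (use c in \<open>auto simp: chain_grp_def\<close>)
    finally show ?thesis by (simp add: sum_distrib_left mult.commute)
  qed
  have "bdry n l c y =
      (\<Sum>i\<in>{1..<l}. \<Sum>x\<in>pchains n l. c x * (if del_at i x = y then (-1) ^ i else 0))"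
    unfolding bdry_def sum_distrib_left by (rule sum.swap)
  then show ?thesis using * by simp
qed

lemma bdry_nonzeroD:
  assumes "bdry n l c y \<noteq> 0"
  shows "\<exists>x\<in>pchains n l. \<exists>i\<in>{1..<l}. del_at i x = y"
proof (rule ccontr)
  assume neg: "\<not> ?thesis"
  have "(\<Sum>i\<in>{1..<l}. if del_at i x = y then (-1) ^ i else 0) = (0 :: 'a)" if "x \<in> pchains n l" for x
    using neg that by (intro sum.neutral) auto
  then have "bdry n l c y = 0" by (simp add: bdry_def)
  then show False using assms by simp
qed

lemma del_at_pchains:
  assumes x: "x \<in> pchains n (Suc l)" and i: "i \<in> {1..<Suc l}"
  shows "del_at i x \<in> pchains n l"
proof -
  have l: "length x = Suc (Suc l)" using x by (simp add: pchains_iff)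
  have s: "sorted_wrt pp_less (take i x @ drop i x)" using x by (simp add: pchains_iff)
  have "drop i x = x ! i # drop (Suc i) x" using l i by (simp add: Cons_nth_drop_Suc)
  with s have "sorted_wrt pp_less (del_at i x)"
    unfolding del_at_def sorted_wrt_append by simp
  moreover have "hd (del_at i x) = hd x" using l i by (simp add: del_at_def hd_append)
  moreover have "last (del_at i x) = last x" using l i by (simp add: del_at_def last_append)
  moreover have "set (del_at i x) \<subseteq> set x"
    unfolding del_at_def using set_take_subset set_drop_subset by fastforce
  moreover have "length (del_at i x) = Suc l" using l i by (simp add: del_at_def)
  ultimately show ?thesis using x by (auto simp: pchains_iff)
qed

lemma bdry_chain_grp: "bdry n (Suc l) c \<in> chain_grp n l"
  unfolding chain_grp_def using bdry_nonzeroD del_at_pchains by blast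

text \<open>The chains starting at a fixed minimal element, with both ends removed, are the simplices
  of an order complex. They are listed downwards so that cones are formed at the head.\<close>

definition slice :: "nat \<Rightarrow> (ppart list \<Rightarrow> 'k) \<Rightarrow> ppart \<Rightarrow> ppart list \<Rightarrow> 'k" where
  "slice n c x zs = c (x # rev zs @ [pp_max n])"

definition interior :: "nat \<Rightarrow> ppart \<Rightarrow> ppart set" where
  "interior n x = {v \<in> pparts n. pp_le x v \<and> x \<noteq> v \<and> pp_le v (pp_max n) \<and> v \<noteq> pp_max n}"

text \<open>Position \<open>i\<close> counted from the minimal element is position
  \<open>Suc k - i\<close> of the reversed interior, whence the global sign.\<close>

lemma bdry_slice:
  assumes c: "c \<in> chain_grp n (Suc (Suc k))" and zs: "length zs = k"
  shows "slice n (bdry n (Suc (Suc k)) c) x zs = (-1) ^ Suc k * diff (pparts n) (slice n c x) zs"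
proof -
  let ?y = "x # rev zs @ [pp_max n]"
  let ?g = "\<lambda>i. (\<Sum>v\<in>pparts n. c (take i ?y @ v # drop i ?y))"
  have "bdry n (Suc (Suc k)) c ?y = (\<Sum>i\<in>{1..<Suc (Suc k)}. (-1) ^ i * ?g i)"
    by (rule bdry_insert[OF c]) (simp add: zs)
  also have "\<dots> = (\<Sum>j\<le>k. (-1) ^ (Suc k - j) * ?g (Suc k - j))"
    by (rule sum.reindex_bij_witness[of _ "\<lambda>j. Suc k - j" "\<lambda>i. Suc k - i"]) auto
  also have "\<dots> = (\<Sum>j\<le>k. (-1) ^ Suc k * ((-1) ^ j *
      (\<Sum>v\<in>pparts n. slice n c x (take j zs @ v # drop j zs))))"
  proof (rule sum.cong)
    fix j assume "j \<in> {..k}"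
    then have j: "j \<le> k" by simp
    then have "(-1 :: 'a) ^ Suc k = (-1) ^ (Suc k - j) * (-1) ^ j"
      by (simp flip: power_add del: power_Suc)
    then have "(-1 :: 'a) ^ Suc k * (-1) ^ j = (-1) ^ (Suc k - j) * ((-1) ^ j * (-1) ^ j)"
      by (simp only: mult.assoc)
    then have s: "(-1 :: 'a) ^ (Suc k - j) = (-1) ^ Suc k * (-1) ^ j"
      by (simp flip: power_mult_distrib)
    have "take (Suc k - j) ?y @ v # drop (Suc k - j) ?y =
        x # rev (take j zs @ v # drop j zs) @ [pp_max n]" for v
      using j zs by (simp add: Suc_diff_le rev_take rev_drop)
    then show "(-1) ^ (Suc k - j) * ?g (Suc k - j) = (-1) ^ Suc k * ((-1) ^ j *
      (\<Sum>v\<in>pparts n. slice n c x (take j zs @ v # drop j zs)))"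
      by (simp only: s slice_def mult.assoc)
  qed simp
  finally show ?thesis
    by (simp add: slice_def diff_insert zs sum_distrib_left)
qed

lemma slice_pchains:
  assumes x: "pp_minimal n x" and n: "n \<ge> 2"
  shows "x # rev zs @ [pp_max n] \<in> pchains n (Suc m) \<longleftrightarrow> zs \<in> pp.desc (interior n x) m"
proof -
  have "x \<in> pparts n" "card x = 1" using x by (auto simp: pp_minimal_iff)
  moreover from this have "x \<noteq> pp_max n" "pp_le x (pp_max n)" using n pp_le_max by auto
  moreover have "sorted_wrt pp_less (rev zs) \<longleftrightarrow> sorted_wrt (\<lambda>a b. pp_le b a \<and> b \<noteq> a) zs"
    by (simp add: sorted_wrt_rev pp_less_def)
  ultimately show ?thesis
    using x by (auto simp: pchains_iff pp.desc_def interior_def sorted_wrt_append pp_less_def)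
qed

lemma slice_chains:
  assumes "c \<in> chain_grp n (Suc m)" "pp_minimal n x" "n \<ge> 2"
  shows "slice n c x \<in> pp.chains (interior n x) m"
  using assms slice_pchains[OF assms(2,3)] by (auto simp: pp.chains_def slice_def chain_grp_def)

lemma bdry_slice_diff:
  assumes c: "c \<in> chain_grp n (Suc (Suc k))" and "pp_minimal n x" "n \<ge> 2"
  shows "slice n (bdry n (Suc (Suc k)) c) x zs = (-1) ^ Suc k * diff (pparts n) (slice n c x) zs"
proof (cases "length zs = k")
  case True
  then show ?thesis using bdry_slice[OF c] by blast
next
  case False
  have "bdry n (Suc (Suc k)) c \<in> chain_grp n (Suc k)" by (rule bdry_chain_grp)
  then have "slice n (bdry n (Suc (Suc k)) c) x zs = 0"
    using False by (auto simp: slice_def chain_grp_def pchains_iff)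
  moreover have "diff (pparts n) (slice n c x) zs = 0"
    using pp.diff_chains[OF slice_chains[OF assms]] False by (auto simp: pp.chains_def pp.desc_def)
  ultimately show ?thesis by simp
qed

lemma chain_slice:
  assumes "y \<in> pchains n (Suc m)"
  shows "\<exists>x zs. pp_minimal n x \<and> y = x # rev zs @ [pp_max n]"
proof -
  have y: "length y = Suc (Suc m)" "last y = pp_max n" "pp_minimal n (hd y)"
    using assms by (auto simp: pchains_iff)
  obtain x ys where y': "y = x # ys" using y(1) by (cases y) auto
  then have "ys \<noteq> []" using y(1) by auto
  with y'
 have "y = x # rev (rev (butlast ys)) @ [pp_max n]" "pp_minimal n x"
    using y append_butlast_last_id[of ys] by auto
  then show ?thesis by blast
qed

text \<open>The differential never deletes the minimal element, so the complex splits into one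
  summand for each of them; this lemma allows identities of chains to be checked on the
  summands.\<close>

lemma chain_grp_eqI:
  assumes "c \<in> chain_grp n (Suc m)" "d \<in> chain_grp n (Suc m)"
    and "\<And>x zs. pp_minimal n x \<Longrightarrow> slice n c x zs = slice n d x zs"
  shows "c = d"
proof
  fix y
  show "c y = d y"
  proof (cases "y \<in> pchains n (Suc m)")
    case True
    then obtain x zs where "pp_minimal n x" "y = x # rev zs @ [pp_max n]"
      using chain_slice by blast
    then show ?thesis using assms(3)[of x zs] by (simp add: slice_def)
  next
    case False
    then show ?thesis using assms(1,2) by (simp add: chain_grp_def)
  qed
qed

lemma chain_grp_zero [simp]: "(\<lambda>_. 0) \<in> chain_grp n l"
  by (simp add: chain_grp_def)

lemma boundaries_subset_cycles:
  assumes n: "n \<ge> 2"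
  shows "boundaries n (Suc m) \<subseteq> cycles n (Suc m)"
proof
  fix z assume "z \<in> boundaries n (Suc m)"
  then obtain c where c: "c \<in> chain_grp n (Suc (Suc m))" "z = bdry n (Suc (Suc m)) c"
    by (auto simp: boundaries_def)
  have z: "z \<in> chain_grp n (Suc m)" using c bdry_chain_grp by blast
  moreover have "bdry n (Suc m) z = (\<lambda>_. 0)"
  proof (cases m)
    case 0
    then show ?thesis by (simp add: bdry_def)
  next
    case (Suc k)
    show ?thesis
    proof (rule chain_grp_eqI)
      show "bdry n (Suc m) z \<in> chain_grp n (Suc k)" using bdry_chain_grp Suc by blast
      fix x zs assume x: "pp_minimal n x"
      have "slice n z x = (\<lambda>zs. (-1) ^ Suc m * diff (pparts n) (slice n c x) zs)"
        using bdry_slice_diff[OF c(1) x n] c(2) by auto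
      then have "diff (pparts n) (slice n z x) zs = 0"
        by (simp only: diff_scale diff_diff mult_zero_right)
      then show "slice n (bdry n (Suc m) z) x zs = slice n (\<lambda>_. 0) x zs"
        using bdry_slice_diff[of z n k x zs] z x n Suc by (simp add: slice_def)
    qed simp
  qed
  ultimately show "z \<in> cycles n (Suc m)" by (simp add: cycles_def)
qed

text \<open>The interval from a minimal element to \<open>pp_max n\<close> has length
  \<open>n - 1\<close>, and a chain of degree \<open>Suc m\<close> has \<open>m\<close> interior
  vertices; the assumption is therefore the bound of \<open>open_interval_acyclic\<close>.\<close>

lemma cycles_subset_boundaries:
  assumes m: "Suc (Suc m) < n"
  shows "(cycles n (Suc m) :: (ppart list \<Rightarrow> 'k::comm_ring_1) set) \<subseteq> boundaries n (Suc m)"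
proof
  fix z :: "ppart list \<Rightarrow> 'k" assume "z \<in> cycles n (Suc m)"
  then have z: "z \<in> chain_grp n (Suc m)" "bdry n (Suc m) z = (\<lambda>_. 0)"
    by (auto simp: cycles_def)
  have n: "n \<ge> 2" using m by simp
  have "\<exists>w\<in>pp.chains (interior n x) (Suc m). \<forall>ys. diff (pparts n) w ys = slice n z x ys"
    if x: "pp_minimal n x" for x
  proof -
    have x': "x \<in> pparts n" "card x = 1" using x by (auto simp: pp_minimal_iff)
    have zx: "slice n z x \<in> pp.chains (interior n x) m" using slice_chains[OF z(1) x n] .
    have "diff (pparts n) (slice n z x) ys = 0" for ys
    proof (cases m)
      case 0
      then show ?thesis using zx pp.diff_chains_0 by blast
    next
      case (Suc k)
      have "(-1) ^ Suc k * diff (pparts n) (slice n z x) ys = 0"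
        using bdry_slice_diff[of z n k x ys] z x n Suc by (simp add: slice_def)
      then have "(-1) ^ Suc k * ((-1) ^ Suc k * diff (pparts n) (slice n z x) ys) = 0" by simp
      then show ?thesis by (simp flip: mult.assoc power_mult_distrib)
    qed
    then show ?thesis
      using pp.open_interval_acyclic[of x n "pp_max n" m "slice n z x"] x' m pp_le_max zx
      by (simp add: interior_def)
  qed
  then obtain w where w: "\<And>x. pp_minimal n x \<Longrightarrow> w x \<in> pp.chains (interior n x) (Suc m)"
    "\<And>x ys. pp_minimal n x \<Longrightarrow> diff (pparts n) (w x) ys = slice n z x ys"
    by metis
  \<comment> \<open>The fillings on the slices are glued according to the first entry; the sign
    cancels the one in \<open>bdry_slice_diff\<close>.\<close>
  define c where "c y = (if y \<in> pchains n (Suc (Suc m))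
    then (-1) ^ Suc m * w (hd y) (rev (butlast (tl y))) else 0)" for y
  have c: "c \<in> chain_grp n (Suc (Suc m))" by (simp add: c_def chain_grp_def)
  have "bdry n (Suc (Suc m)) c = z"
  proof (rule chain_grp_eqI)
    show "bdry n (Suc (Suc m)) c \<in> chain_grp n (Suc m)" by (rule bdry_chain_grp)
    fix x zs assume x: "pp_minimal n x"
    have "slice n c x ys = (-1) ^ Suc m * w x ys" for ys
      using w(1)[OF x] slice_pchains[OF x n, of ys "Suc m"]
      by (simp add: slice_def c_def pp.chains_def)
    then have "slice n c x = (\<lambda>ys. (-1) ^ Suc m * w x ys)" by blast
    then have "slice n (bdry n (Suc (Suc m)) c) x zs =
        (-1) ^ Suc m * ((-1) ^ Suc m * slice n z x zs)"
      by (simp only: bdry_slice_diff[OF c x n] diff_scale w(2)[OF x])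
    then show "slice n (bdry n (Suc (Suc m)) c) x zs = slice n z x zs"
      by (simp flip: mult.assoc power_mult_distrib)
  qed (rule z(1))
  then show "z \<in> boundaries n (Suc m)" using c unfolding boundaries_def by blast
qed

text \<open>Block counts increase strictly along a chain and lie between 1 and \<open>n\<close>, so
  at most \<open>n\<close> entries fit.\<close>

lemma pchains_empty:
  assumes "l \<ge> n" "n \<ge> 1"
  shows "pchains n l = {}"
proof (rule ccontr)
  assume "pchains n l \<noteq> {}"
  then obtain xs where xs: "xs \<in> pchains n l" by blast
  then have "sorted_wrt (<) (map card xs)" using sorted_card by (auto simp: pchains_iff)
  then have "distinct (map card xs)" by (simp add: strict_sorted_iff)
  moreover have "set (map card xs) \<subseteq> {1..n}"
  proof
    fix k assume "k \<in> set (map card xs)"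
    then obtain x where x: "x \<in> pparts n" "k = card x" using xs by (auto simp: pchains_iff)
    have "card x \<le> n" using pp_le_card[OF x(1) pp_max_pparts pp_le_max[OF x(1)]] by fastforce
    moreover have "x \<noteq> {}" using pparts_block[OF x(1), of 1] assms by auto
    ultimately show "k \<in> {1..n}" using x pparts_finite by (auto simp: Suc_le_eq card_gt_0_iff)
  qed
  ultimately have "length (map card xs) \<le> n"
    by (metis card_atLeastAtMost card_mono diff_Suc_1 distinct_card finite_atLeastAtMost)
  then show False using xs assms by (simp add: pchains_iff)
qed

lemma cycles_eq_boundaries:
  assumes n: "n \<ge> 1" and l: "l \<noteq> n - 1"
  shows "(cycles n l :: (ppart list \<Rightarrow> 'k::comm_ring_1) set) = boundaries n l"
proof -
  \<comment> \<open>This treats the degrees without chains: \<open>l \<ge> n\<close>, and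
    \<open>l = 0\<close> for \<open>n \<ge> 2\<close>. In degree 0 the boundaries vanish because
    \<open>bdry n 1\<close> has no position to delete.\<close>
  have triv: ?thesis if "pchains n l = {}" "l = 0 \<or> pchains n (Suc l) = {}"
  proof -
    have "c = (\<lambda>_. 0)" if "c \<in> chain_grp n l" for c :: "ppart list \<Rightarrow> 'k"
      using that \<open>pchains n l = {}\<close> by (intro ext) (simp add: chain_grp_def)
    then have "chain_grp n l = {\<lambda>_. 0 :: 'k}" using chain_grp_zero by blast
    moreover have "bdry n l (\<lambda>_. 0) = (\<lambda>_. 0 :: 'k)" by (simp add: bdry_def)
    ultimately have "cycles n l = {\<lambda>_. 0 :: 'k}" unfolding cycles_def by blast
    moreover have "bdry n (Suc l) c = (\<lambda>_. 0)" for c :: "ppart list \<Rightarrow> 'k"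
      using that(2) by (auto simp: bdry_def)
    then have "boundaries n l = {\<lambda>_. 0 :: 'k}"
      unfolding boundaries_def
      by (simp add: image_constant_conv) (use chain_grp_zero in blast)
    ultimately show ?thesis by (rule trans[OF _ sym])
  qed
  consider "l \<ge> n" | "l = 0" "n \<ge> 2" | m where "l = Suc m" "Suc l < n"
    using n l by (cases l) force+
  then show ?thesis
  proof cases
    case 1
    then show ?thesis using triv pchains_empty n by simp
  next
    case 2
    have "pchains n 0 = {}"
    proof (rule ccontr)
      assume "pchains n 0 \<noteq> {}"
      then obtain xs where "xs \<in> pchains n 0" by blast
      then have "pp_minimal n (pp_max n)" by (cases xs) (auto simp: pchains_iff)
      then show False using 2 by (simp add: pp_minimal_def)
    qed
    then show ?thesis using triv 2 by simp
  next
    case 3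
    then show ?thesis
      by (simp add: subset_antisym[OF cycles_subset_boundaries boundaries_subset_cycles])
  qed
qed

subsection \<open>Maximal chains as words of merges\<close>

text \<open>A letter \<open>(p, q)\<close> merges the blocks pointed at \<open>p\<close> and \<open>q\<close> and keeps the point \<open>p\<close>; a word
  describes a chain from its maximal element downwards.\<close>

fun word_ok :: "nat set \<Rightarrow> (nat \<times> nat) list \<Rightarrow> bool" where
  "word_ok S [] \<longleftrightarrow> True"
| "word_ok S ((p, q) # w) \<longleftrightarrow> p \<in> S \<and> q \<in> S \<and> p \<noteq> q \<and> word_ok (S - {q}) w"

definition words :: "nat \<Rightarrow> (nat \<times> nat) list set" where
  "words n = {w. word_ok {1..n} w \<and> length w = n - 1}"

fun states :: "ppart \<Rightarrow> (nat \<times> nat) list \<Rightarrow> ppart list" where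
  "states y [] = [y]"
| "states y ((p, q) # w) = y # states (merge y p q) w"

text \<open>The last state is left out so that concatenating words does not list the junction
  twice.\<close>

fun prestates :: "ppart \<Rightarrow> (nat \<times> nat) list \<Rightarrow> ppart list" where
  "prestates y [] = []"
| "prestates y ((p, q) # w) = y # prestates (merge y p q) w"

fun final :: "ppart \<Rightarrow> (nat \<times> nat) list \<Rightarrow> ppart" where
  "final y [] = y"
| "final y ((p, q) # w) = final (merge y p q) w"

definition chain_of :: "nat \<Rightarrow> (nat \<times> nat) list \<Rightarrow> ppart list" where
  "chain_of n w = rev (states (pp_max n) w)"

lemma word_ok_append:
  "word_ok S (u @ v) \<longleftrightarrow> word_ok S u \<and> word_ok (S - snd ` set u) v"
proof (induction S u rule: word_ok.induct)
  case (2 S p q w)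
  then show ?case by (simp add: Diff_insert2[of S q "snd ` set w"])
qed simp

lemma states_append: "states y (u @ v) = prestates y u @ states (final y u) v"
  by (induction y u rule: prestates.induct) auto

lemma length_states [simp]: "length (states y w) = Suc (length w)"
  by (induction y w rule: states.induct) auto

lemma length_prestates [simp]: "length (prestates y w) = length w"
  by (induction y w rule: prestates.induct) auto

lemma states_nonempty [simp]: "states y w \<noteq> []"
  by (cases "(y, w)" rule: states.cases) auto

lemma hd_states [simp]: "hd (states y w) = y"
  by (cases "(y, w)" rule: states.cases) auto

lemma last_states [simp]: "last (states y w) = final y w"
  by (induction y w rule: states.induct) auto

lemma final_pparts:
  assumes "y \<in> pparts n" "word_ok (snd ` y) w"
  shows "final y w \<in> pparts n \<and> snd ` final y w = snd ` y - snd ` set w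
    \<and> card (final y w) + length w = card y"
  using assms
proof (induction y w rule: final.induct)
  case (2 y p q w)
  then have pq: "p \<in> snd ` y" "q \<in> snd ` y" "p \<noteq> q" by auto
  note m = merge_pparts[OF "2.prems"(1) pq] snd_merge[OF "2.prems"(1) pq]
    card_merge[OF "2.prems"(1) pq]
  then show ?case using "2.IH" "2.prems" by auto
qed auto

lemma merge_less:
  assumes "y \<in> pparts n" "p \<in> snd ` y" "q \<in> snd ` y" "p \<noteq> q"
  shows "pp_less (merge y p q) y"
  using merge_le[OF assms] card_merge[OF assms] by (auto simp: pp_less_def)

lemma states_chain:
  assumes "y \<in> pparts n" "word_ok (snd ` y) w"
  shows "set (states y w) \<subseteq> pparts n \<and> successively (\<lambda>a b. pp_less b a) (states y w)"
  using assms
proof (induction y w rule: states.induct)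
  case (2 y p q w)
  then have pq: "p \<in> snd ` y" "q \<in> snd ` y" "p \<noteq> q" by auto
  note m = merge_pparts[OF "2.prems"(1) pq] snd_merge[OF "2.prems"(1) pq]
    merge_less[OF "2.prems"(1) pq]
  then show ?case using "2.IH" "2.prems" by (auto simp: successively_Cons)
qed auto

lemma sorted_pp_less_iff:
  assumes "set xs \<subseteq> pparts n"
  shows "sorted_wrt pp_less xs \<longleftrightarrow> successively pp_less xs"
  by (rule successively_iff_sorted_wrt_strong[symmetric]) (use assms pp_less_trans in blast)

lemma chain_of_pchains:
  assumes w: "w \<in> words n" and n: "n \<ge> 1"
  shows "chain_of n w \<in> pchains n (n - 1)"
proof -
  have ok: "word_ok (snd ` pp_max n) w" and l: "length w = n - 1"
    using w by (auto simp: words_def)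
  note f = final_pparts[OF pp_max_pparts ok]
  have "pp_minimal n (final (pp_max n) w)"
    unfolding pp_minimal_iff using f l n card_pp_max[of n] by linarith
  moreover have "set (states (pp_max n) w) \<subseteq> pparts n"
    "sorted_wrt pp_less (rev (states (pp_max n) w))"
    using states_chain[OF pp_max_pparts ok]
    by (auto simp: sorted_pp_less_iff[of _ n])
  ultimately show ?thesis
    using l n by (simp add: pchains_iff chain_of_def hd_rev last_rev)
qed

text \<open>The missing point determines \<open>q\<close>, and \<open>p\<close> is then the point of
  the block that contains \<open>q\<close>.\<close>

lemma merge_inj:
  assumes y: "y \<in> pparts n" and p: "p \<in> snd ` y" "q \<in> snd ` y" "p \<noteq> q"
    and r: "r \<in> snd ` y" "s \<in> snd ` y" "r \<noteq> s" and eq: "merge y p q = merge y r s"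
  shows "p = r \<and> q = s"
proof -
  have "snd ` y - {q} = snd ` y - {s}"
    using snd_merge[OF y p] snd_merge[OF y r] eq by simp
  then have qs: "q = s" using p r by auto
  have q: "q \<in> blk y q" using blk_in[OF y p(2)] pparts_pointD[OF y] by blast
  have "(blk y p \<union> blk y q, p) \<in> merge y p q" "(blk y r \<union> blk y q, r) \<in> merge y r s"
    by (simp_all add: merge_mem qs)
  then have "(blk y p \<union> blk y q, p) \<in> merge y p q" "(blk y r \<union> blk y q, r) \<in> merge y p q"
    by (simp_all only: eq)
  then show ?thesis using pparts_unique[OF merge_pparts[OF y p]] q qs by blast
qed

lemma states_inj:
  assumes "y \<in> pparts n" "word_ok (snd ` y) w" "word_ok (snd ` y) w'" "states y w = states y w'"
  shows "w = w'"
  using assms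
proof (induction w arbitrary: y w')
  case Nil
  show ?case using arg_cong[OF Nil.prems(4), of length] by simp
next
  case (Cons e w)
  obtain p q where e: "e = (p, q)" by (cases e)
  obtain r s v where w': "w' = (r, s) # v"
    using Cons.prems e by (cases "(y, w')" rule: states.cases) auto
  have pq: "p \<in> snd ` y" "q \<in> snd ` y" "p \<noteq> q" and rs: "r \<in> snd ` y" "s \<in> snd ` y" "r \<noteq> s"
    using Cons.prems e w' by auto
  have st: "states (merge y p q) w = states (merge y r s) v" using Cons.prems e w' by simp
  then have "merge y p q = merge y r s" by (metis hd_states)
  then have "p = r \<and> q = s" using merge_inj Cons.prems(1) pq rs by blast
  then show ?case
    using Cons.IH[of "merge y p q" v] Cons.prems e w' st merge_pparts[OF _ pq]
      snd_merge[OF _ pq] by auto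
qed

lemma chain_of_inj:
  assumes "w \<in> words n" "w' \<in> words n" "chain_of n w = chain_of n w'"
  shows "w = w'"
  using assms states_inj[of "pp_max n" n w w'] by (auto simp: words_def chain_of_def)

text \<open>The count of blocks forces each step of the chain to lose exactly one block, hence to be
  a single merge.\<close>

lemma states_surj:
  assumes "set (y # zs) \<subseteq> pparts n" "successively (\<lambda>a b. pp_less b a) (y # zs)"
    "card y = card (last (y # zs)) + length zs"
  shows "\<exists>w. word_ok (snd ` y) w \<and> states y w = y # zs"
  using assms
proof (induction zs arbitrary: y)
  case Nil
  show ?case by (rule exI[of _ "[]"]) simp
next
  case (Cons z zs)
  have yz: "y \<in> pparts n" "z \<in> pparts n" "pp_le z y" "z \<noteq> y"
    using Cons.prems by (auto simp: pp_less_def)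
  have "card (last (z # zs)) + length zs \<le> card z"
    if "set (z # zs) \<subseteq> pparts n" "successively (\<lambda>a b. pp_less b a) (z # zs)" for z zs
    using that
  proof (induction zs arbitrary: z)
    case (Cons u us)
    then have "card (last (u # us)) + length us \<le> card u" by simp
    moreover have "card u < card z"
      using Cons.prems pp_le_card[of u n z] by (simp add: pp_less_def)
    ultimately show ?case by simp
  qed simp
  from this[of z zs] have "card (last (z # zs)) + length zs \<le> card z" using Cons.prems by simp
  then have c: "card y = Suc (card z)" "card z = card (last (z # zs)) + length zs"
    using pp_le_card[OF yz(2,1,3,4)] Cons.prems(3) by auto
  obtain p q where pq: "p \<in> snd ` y" "q \<in> snd ` y" "p \<noteq> q" "z = merge y p q"
    using covered_is_merge[OF yz(2,1,3) c(1)] by blast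
  obtain w where w: "word_ok (snd ` z) w" "states z w = z # zs"
    using Cons.IH[of z] Cons.prems c(2) by auto
  then show ?case
    using pq snd_merge[OF yz(1) pq(1-3)] by (intro exI[of _ "(p, q) # w"]) simp
qed

lemma chain_of_surj:
  assumes x: "x \<in> pchains n (n - 1)" and n: "n \<ge> 1"
  shows "\<exists>w\<in>words n. chain_of n w = x"
proof -
  have l: "length x = n" using x n by (simp add: pchains_iff)
  then obtain zs where zs: "rev x = pp_max n # zs"
    using x n by (cases "rev x") (auto simp: pchains_iff simp flip: hd_rev)
  have "last (rev x) = hd x" using l n by (simp add: last_rev)
  moreover have "length zs = n - 1" using l zs by (metis diff_Suc_1 length_Cons length_rev)
  moreover have "set (rev x) \<subseteq> pparts n" "successively (\<lambda>a b. pp_less b a) (rev x)"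
    using x sorted_pp_less_iff[of x n] by (auto simp: pchains_iff)
  ultimately obtain w where w: "word_ok {1..n} w" "states (pp_max n) w = rev x"
    using states_surj[of "pp_max n" zs n] x n unfolding zs by (auto simp: pchains_iff pp_minimal_iff)
  then have "length w = n - 1" using l by (metis length_rev length_states diff_Suc_1)
  then show ?thesis using w by (intro bexI[of _ w]) (auto simp: words_def chain_of_def)
qed

subsection \<open>Intervals of length two\<close>

lemma blk_merge:
  "blk (merge y p q) t = (if t = p then blk y p \<union> blk y q else if t = q then {} else blk y t)"
  unfolding blk_def merge_mem by auto

lemma merge_commute:
  assumes "{p, q} \<inter> {r, s} = {}"
  shows "merge (merge y p q) r s = merge (merge y r s) p q"
proof -
  have "(D, d) \<in> merge (merge y p q) r s \<longleftrightarrow> (D, d) \<in> merge (merge y r s) p q" for D d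
    using assms unfolding merge_mem blk_merge by auto
  then show ?thesis by auto
qed

text \<open>All four routes end in the union of the three blocks pointed at \<open>a\<close>:
  \<open>b\<close> and \<open>c\<close> are absorbed by \<open>a\<close> in either order, or are
  first merged with each other, keeping either point.\<close>

lemma merge_triple:
  assumes "a \<noteq> b" "a \<noteq> c" "b \<noteq> c"
  shows "merge (merge y a c) a b = merge (merge y a b) a c"
    and "merge (merge y b c) a b = merge (merge y a b) a c"
    and "merge (merge y c b) a c = merge (merge y a b) a c"
proof -
  have "(D, d) \<in> merge (merge y a c) a b \<longleftrightarrow> (D, d) \<in> merge (merge y a b) a c"
    "(D, d) \<in> merge (merge y b c) a b \<longleftrightarrow> (D, d) \<in> merge (merge y a b) a c"
    "(D, d) \<in> merge (merge y c b) a c \<longleftrightarrow> (D, d) \<in> merge (merge y a b) a c" for D d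
    using assms unfolding merge_mem blk_merge by auto
  then show "merge (merge y a c) a b = merge (merge y a b) a c"
    "merge (merge y b c) a b = merge (merge y a b) a c"
    "merge (merge y c b) a c = merge (merge y a b) a c" by auto
qed

lemma point_in_blk:
  assumes "y \<in> pparts n" "s \<in> snd ` y" "t \<in> snd ` y"
  shows "s \<in> blk y t \<longleftrightarrow> s = t"
  using blk_in[OF assms(1,2)] blk_in[OF assms(1,3)] pparts_pointD[OF assms(1)]
    pparts_unique[OF assms(1)] by blast

lemma between_is_merge:
  assumes y: "y \<in> pparts n" and x: "x \<in> pparts n" and c: "card y = Suc (Suc (card x))"
    and v: "v \<in> pparts n" "pp_less x v" "pp_less v y"
  shows "\<exists>s t D d. s \<in> snd ` y \<and> t \<in> snd ` y \<and> s \<noteq> t \<and> v = merge y s t \<and>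
    (D, d) \<in> x \<and> s \<in> D \<and> t \<in> D \<and> d \<noteq> t"
proof -
  have "card x < card v" "card v < card y"
    using v x y pp_le_card by (auto simp: pp_less_def)
  then have "card y = Suc (card v)" using c by simp
  then obtain s t where st: "s \<in> snd ` y" "t \<in> snd ` y" "s \<noteq> t" "v = merge y s t"
    using covered_is_merge[OF v(1) y] v by (auto simp: pp_less_def)
  moreover have "pp_le x (merge y s t)" using v st by (simp add: pp_less_def)
  ultimately show ?thesis using le_merge_iff[OF y st(1-3) x] by blast
qed

lemma interval_disjoint:
  assumes y: "y \<in> pparts n" and p: "p \<in> snd ` y" "q \<in> snd ` y" "p \<noteq> q"
    and r: "r \<in> snd ` y" "s \<in> snd ` y" "r \<noteq> s" and dis: "{p, q} \<inter> {r, s} = {}"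
  shows "{v \<in> pparts n. pp_less (merge (merge y p q) r s) v \<and> pp_less v y}
    = {merge y p q, merge y r s}" (is "?I = _")
proof
  let ?x = "merge (merge y p q) r s"
  note P = merge_pparts[OF y p] and R = merge_pparts[OF y r]
  have r': "r \<in> snd ` merge y p q" "s \<in> snd ` merge y p q"
    and p': "p \<in> snd ` merge y r s" "q \<in> snd ` merge y r s"
    using snd_merge[OF y p] snd_merge[OF y r] p r dis by auto
  have "pp_less ?x (merge y p q)" using merge_less[OF P r' r(3)] .
  moreover have "pp_less ?x (merge y r s)"
    using merge_less[OF R p' p(3)] merge_commute[OF dis] by simp
  ultimately show "{merge y p q, merge y r s} \<subseteq> ?I"
    using P R merge_less[OF y p] merge_less[OF y r] by auto
  show "?I \<subseteq> {merge y p q, merge y r s}"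
  proof
    fix v assume "v \<in> ?I"
    moreover have "card y = Suc (Suc (card ?x))"
      using card_merge[OF y p] card_merge[OF P r' r(3)] by simp
    ultimately obtain i j D d where v: "i \<in> snd ` y" "j \<in> snd ` y" "i \<noteq> j" "v = merge y i j"
      and D: "(D, d) \<in> ?x" "i \<in> D" "j \<in> D" "d \<noteq> j"
      using between_is_merge[OF y merge_pparts[OF P r' r(3)]] by blast
    note pt = point_in_blk[OF y]
    have "D = blk y p \<union> blk y q \<and> d = p \<or> D = blk y r \<union> blk y s \<and> d = r \<or> D = blk y d \<and> d \<in> snd ` y"
      using D(1) dis blk_eq[OF y] unfolding merge_mem blk_merge points_iff by auto
    then have "(i, j) = (p, q) \<or> (i, j) = (r, s)"
    proof (elim disjE)
      assume "D = blk y p \<union> blk y q \<and> d = p"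
      then show ?thesis
        using D(2-) v(3) pt[OF v(1) p(1)] pt[OF v(1) p(2)] pt[OF v(2) p(1)] pt[OF v(2) p(2)] by auto
    next
      assume "D = blk y r \<union> blk y s \<and> d = r"
      then show ?thesis
        using D(2-) v(3) pt[OF v(1) r(1)] pt[OF v(1) r(2)] pt[OF v(2) r(1)] pt[OF v(2) r(2)] by auto
    next
      assume "D = blk y d \<and> d \<in> snd ` y"
      then show ?thesis using D(2-) v(3) pt[OF v(1), of d] pt[OF v(2), of d] by simp
    qed
    then show "v \<in> {merge y p q, merge y r s}" using v by auto
  qed
qed

text \<open>An intermediate element merges two of the three blocks, and it cannot give up
  \<open>a\<close>, which is still a point at the bottom. Of the six ordered pairs this leaves
  four.\<close>

lemma interval_triple:
  assumes y: "y \<in> pparts n" and a: "a \<in> snd ` y" and b: "b \<in> snd ` y" and c: "c \<in> snd ` y"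
    and ne: "a \<noteq> b" "a \<noteq> c" "b \<noteq> c"
  shows "{v \<in> pparts n. pp_less (merge (merge y a b) a c) v \<and> pp_less v y}
    = {merge y a b, merge y a c, merge y b c, merge y c b}" (is "?I = ?R")
proof
  let ?x = "merge (merge y a b) a c"
  note ne' = ne[symmetric]
  have ab: "a \<in> snd ` merge y a b" "c \<in> snd ` merge y a b"
    and ac: "a \<in> snd ` merge y a c" "b \<in> snd ` merge y a c"
    and bc: "a \<in> snd ` merge y b c" "b \<in> snd ` merge y b c"
    and cb: "a \<in> snd ` merge y c b" "c \<in> snd ` merge y c b"
    using snd_merge[OF y a b ne(1)] snd_merge[OF y a c ne(2)] snd_merge[OF y b c ne(3)]
      snd_merge[OF y c b ne'(3)] a b c ne by auto
  note AB = merge_pparts[OF y a b ne(1)] and AC = merge_pparts[OF y a c ne(2)]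
    and BC = merge_pparts[OF y b c ne(3)] and CB = merge_pparts[OF y c b ne'(3)]
  have "pp_less ?x (merge y a b)" "pp_less ?x (merge y a c)" "pp_less ?x (merge y b c)"
    "pp_less ?x (merge y c b)"
    using merge_less[OF AB ab ne(2)] merge_less[OF AC ac ne(1)] merge_less[OF BC bc ne(1)]
      merge_less[OF CB cb ne(2)] merge_triple[OF ne] by auto
  then show "?R \<subseteq> ?I"
    using AB AC BC CB merge_less[OF y a b ne(1)] merge_less[OF y a c ne(2)]
      merge_less[OF y b c ne(3)] merge_less[OF y c b ne'(3)] by auto
  show "?I \<subseteq> ?R"
  proof
    fix v assume "v \<in> ?I"
    moreover have "card y = Suc (Suc (card ?x))"
      using card_merge[OF y a b ne(1)] card_merge[OF AB ab ne(2)] by simp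
    ultimately obtain i j D d where v: "i \<in> snd ` y" "j \<in> snd ` y" "i \<noteq> j" "v = merge y i j"
      and D: "(D, d) \<in> ?x" "i \<in> D" "j \<in> D" "d \<noteq> j"
      using between_is_merge[OF y merge_pparts[OF AB ab ne(2)]] by blast
    note pt = point_in_blk[OF y]
    have "D = blk y a \<union> blk y b \<union> blk y c \<and> d = a \<or> D = blk y d \<and> d \<in> snd ` y"
      using D(1) ne blk_eq[OF y] unfolding merge_mem blk_merge points_iff by auto
    then have "i \<in> {a, b, c} \<and> j \<in> {b, c}"
    proof
      assume "D = blk y a \<union> blk y b \<union> blk y c \<and> d = a"
      then show ?thesis
        using D(2-) pt[OF v(1) a] pt[OF v(1) b] pt[OF v(1) c] pt[OF v(2) a] pt[OF v(2) b]
          pt[OF v(2) c] by auto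
    next
      assume "D = blk y d \<and> d \<in> snd ` y"
      then show ?thesis using D(2-) v(3) pt[OF v(1), of d] pt[OF v(2), of d] by simp
    qed
    then show "v \<in> ?R" using v(3,4) by auto
  qed
qed

subsection \<open>Top-dimensional cycles\<close>

lemma strict_sorted_nth_ge:
  fixes ks :: "nat list"
  assumes "sorted_wrt (<) ks" "i \<le> j" "j < length ks"
  shows "ks ! i + (j - i) \<le> ks ! j"
  using assms(2,3)
proof (induction j rule: dec_induct)
  case (step j)
  then have "ks ! j < ks ! Suc j" using sorted_wrt_nth_less[OF assms(1), of j "Suc j"] by simp
  then show ?case using step by simp
qed simp

lemma pchains_top_card:
  assumes x: "x \<in> pchains n (n - 1)" and n: "n \<ge> 1" and j: "j < n"
  shows "card (x ! j) = Suc j"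
proof -
  have l: "length x = n" using x n by (simp add: pchains_iff)
  then have ne: "x \<noteq> []" using n by auto
  have s: "sorted_wrt (<) (map card x)" using x sorted_card by (auto simp: pchains_iff)
  have "card (x ! 0) = 1" "card (x ! (n - 1)) = n"
    using x l ne by (auto simp: pchains_iff pp_minimal_iff hd_conv_nth last_conv_nth)
  moreover have "card (x ! 0) + j \<le> card (x ! j)" "card (x ! j) + (n - 1 - j) \<le> card (x ! (n - 1))"
    using strict_sorted_nth_ge[OF s, of 0 j] strict_sorted_nth_ge[OF s, of j "n - 1"] l j by auto
  ultimately show ?thesis using j by linarith
qed

text \<open>A maximal chain meets every rank exactly once, so a list missing one rank can be
  completed only at that place. The alternating sum in the boundary collapses to one term, and the
  cycle condition becomes local.\<close>

lemma cycles_top_iff: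
  assumes c: "c \<in> chain_grp n (n - 1)" and n: "n \<ge> 1"
  shows "c \<in> cycles n (n - 1) \<longleftrightarrow> (\<forall>T V U. T \<noteq> [] \<longrightarrow> U \<noteq> [] \<longrightarrow> T @ V # U \<in> pchains n (n - 1) \<longrightarrow>
    (\<Sum>v\<in>pparts n. c (T @ v # U)) = 0)"
proof (intro iffI allI impI)
  fix T V U
  assume cyc: "c \<in> cycles n (n - 1)" and T: "T \<noteq> []" and U: "U \<noteq> []"
    and x: "T @ V # U \<in> pchains n (n - 1)"
  let ?y = "T @ U" and ?k = "length T"
  have l: "length ?y = n - 1" using x by (simp add: pchains_iff)
  have ln: "length T + length U < n" "?k < n" using l n by auto
  have zero: "c (take i ?y @ v # drop i ?y) = 0" if i: "i \<in> {1..<n - 1}" "i \<noteq> ?k" for i v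
  proof -
    have "take i ?y @ v # drop i ?y \<notin> pchains n (n - 1)"
    proof
      assume x': "take i ?y @ v # drop i ?y \<in> pchains n (n - 1)" (is "?x' \<in> _")
      have i': "i < length ?y" using i l by simp
      show False
      proof (cases "i < ?k")
        case True
        then have "?x' ! Suc i = T ! i" "(T @ V # U) ! i = T ! i"
          using i' by (auto simp: nth_append)
        moreover have "i < n" "Suc i < n" using i by auto
        ultimately show False
          using pchains_top_card[OF x' n, of "Suc i"] pchains_top_card[OF x n, of i] by simp
      next
        case False
        then have "?k < i" using i by simp
        then have "?x' ! ?k = U ! 0" "(T @ V # U) ! Suc ?k = U ! 0"
          using i' U by (auto simp: nth_append)
        moreover have "Suc ?k < n" using U ln by (cases U) auto
        ultimately show False
          using pchains_top_card[OF x' n, of ?k] pchains_top_card[OF x n, of "Suc ?k"] by simp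
      qed
    qed
    then show ?thesis using c by (simp add: chain_grp_def)
  qed
  have k: "?k \<in> {1..<n - 1}" using T U l by (cases T; cases U) auto
  have "0 = (\<Sum>i\<in>{1..<n - 1}. (-1) ^ i * (\<Sum>v\<in>pparts n. c (take i ?y @ v # drop i ?y)))"
    using bdry_insert[OF c l] cyc by (simp add: cycles_def)
  also have "\<dots> = (\<Sum>i\<in>{?k}. (-1) ^ i * (\<Sum>v\<in>pparts n. c (take i ?y @ v # drop i ?y)))"
    by (rule sum.mono_neutral_right) (use k zero in auto)
  also have "\<dots> = (-1) ^ ?k * (\<Sum>v\<in>pparts n. c (T @ v # U))" by simp
  finally have "(-1) ^ ?k * 0 = (-1) ^ ?k * ((-1) ^ ?k * (\<Sum>v\<in>pparts n. c (T @ v # U)))" by simp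
  then show "(\<Sum>v\<in>pparts n. c (T @ v # U)) = 0"
    by (simp flip: mult.assoc power_mult_distrib)
next
  assume R: "\<forall>T V U. T \<noteq> [] \<longrightarrow> U \<noteq> [] \<longrightarrow> T @ V # U \<in> pchains n (n - 1) \<longrightarrow>
    (\<Sum>v\<in>pparts n. c (T @ v # U)) = 0"
  have "bdry n (n - 1) c y = 0" for y
  proof (rule ccontr)
    assume nz: "bdry n (n - 1) c y \<noteq> 0"
    then obtain x i where "x \<in> pchains n (n - 1)" "i \<in> {1..<n - 1}" "del_at i x = y"
      using bdry_nonzeroD by blast
    then have y: "length y = n - 1" by (auto simp: pchains_iff del_at_def)
    have "(\<Sum>v\<in>pparts n. c (take i y @ v # drop i y)) = 0" if i: "i \<in> {1..<n - 1}" for i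
    proof (cases "\<exists>v. take i y @ v # drop i y \<in> pchains n (n - 1)")
      case True
      moreover have "take i y \<noteq> []" "drop i y \<noteq> []" using i y by auto
      ultimately show ?thesis using R by blast
    next
      case False
      then show ?thesis using c by (intro sum.neutral) (auto simp: chain_grp_def)
    qed
    then show False using nz bdry_insert[OF c y] by simp
  qed
  then show "c \<in> cycles n (n - 1)" using c by (auto simp: cycles_def)
qed

text \<open>The local sum of the cycle condition in words: \<open>u\<close> descends from the
  maximal element, \<open>v\<close> continues from \<open>x\<close>, and \<open>z\<close> fills the
  one missing rank.\<close>

definition fillings :: "nat \<Rightarrow> (ppart list \<Rightarrow> 'k::comm_ring_1) \<Rightarrow> (nat \<times> nat) list \<Rightarrow> ppart
    \<Rightarrow> (nat \<times> nat) list \<Rightarrow> 'k" where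
  "fillings n c u x v = (\<Sum>z\<in>pparts n. c (rev (states x v) @ z #
     rev (prestates (pp_max n) u @ [final (pp_max n) u])))"

lemma fillings_between:
  assumes "c \<in> chain_grp n l"
  shows "fillings n c u x v =
    (\<Sum>z\<in>{z \<in> pparts n. pp_less x z \<and> pp_less z (final (pp_max n) u)}.
      c (rev (states x v) @ z # rev (prestates (pp_max n) u @ [final (pp_max n) u])))"
  unfolding fillings_def
proof (rule sum.mono_neutral_right)
  let ?l = "\<lambda>z. rev (states x v) @ z # rev (prestates (pp_max n) u @ [final (pp_max n) u])"
  have "pp_less x z \<and> pp_less z (final (pp_max n) u)" if "?l z \<in> pchains n l" for z
  proof -
    have "sorted_wrt pp_less (?l z)" using that by (simp add: pchains_iff)
    moreover have "x \<in> set (states x v)" using hd_in_set[OF states_nonempty[of x v]] by simp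
    ultimately show ?thesis by (auto simp: sorted_wrt_append)
  qed
  then show "\<forall>z\<in>pparts n - {z \<in> pparts n. pp_less x z \<and> pp_less z (final (pp_max n) u)}. c (?l z) = 0"
    using assms by (auto simp: chain_grp_def)
qed auto

lemma chain_of_split:
  "chain_of n (u @ (p, q) # (r, s) # v) =
    rev (states (merge (merge (final (pp_max n) u) p q) r s) v) @ merge (final (pp_max n) u) p q #
    rev (prestates (pp_max n) u @ [final (pp_max n) u])"
  by (simp add: chain_of_def states_append)

lemma word_ok_two:
  "word_ok S ((p, q) # (r, s) # v) \<longleftrightarrow> p \<in> S \<and> q \<in> S \<and> r \<in> S \<and> s \<in> S \<and> p \<noteq> q \<and> r \<noteq> s \<and>
    r \<noteq> q \<and> s \<noteq> q \<and> word_ok (S - {q, s}) v"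
  by (auto simp: Diff_insert2[of S q "{s}"])

lemma words_two:
  "u @ (p, q) # (r, s) # v \<in> words n \<longleftrightarrow> word_ok {1..n} u \<and>
    word_ok ({1..n} - snd ` set u) ((p, q) # (r, s) # v) \<and> Suc (Suc (length u + length v)) = n - 1"
  by (auto simp: words_def word_ok_append)

lemma final_words:
  assumes "u @ v \<in> words n"
  shows "final (pp_max n) u \<in> pparts n \<and> snd ` final (pp_max n) u = {1..n} - snd ` set u"
  using final_pparts[of "pp_max n" n u] assms by (simp add: words_def word_ok_append)

lemma fillings_disjoint:
  assumes c: "c \<in> chain_grp n l" and w: "u @ (p, q) # (r, s) # v \<in> words n"
    and dis: "{p, q} \<inter> {r, s} = {}"
  shows "fillings n c u (merge (merge (final (pp_max n) u) p q) r s) v =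
    c (chain_of n (u @ (p, q) # (r, s) # v)) + c (chain_of n (u @ (r, s) # (p, q) # v))"
proof -
  let ?y = "final (pp_max n) u"
  have y: "?y \<in> pparts n" "snd ` ?y = {1..n} - snd ` set u" using final_words[OF w] by auto
  have pq: "p \<in> snd ` ?y" "q \<in> snd ` ?y" "p \<noteq> q" and rs: "r \<in> snd ` ?y" "s \<in> snd ` ?y" "r \<noteq> s"
    using w unfolding words_two word_ok_two y by auto
  have ne: "merge ?y p q \<noteq> merge ?y r s"
    using merge_inj[OF y(1) pq rs] dis by auto
  show ?thesis
    unfolding fillings_between[OF c] interval_disjoint[OF y(1) pq rs dis] chain_of_split
    using ne merge_commute[OF dis, of ?y] by simp
qed

lemma fillings_triple:
  assumes c: "c \<in> chain_grp n l" and w: "u @ (a, b) # (a, d) # v \<in> words n"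
  shows "fillings n c u (merge (merge (final (pp_max n) u) a b) a d) v =
    c (chain_of n (u @ (a, b) # (a, d) # v)) + c (chain_of n (u @ (a, d) # (a, b) # v)) +
    c (chain_of n (u @ (b, d) # (a, b) # v)) + c (chain_of n (u @ (d, b) # (a, d) # v))"
proof -
  let ?y = "final (pp_max n) u"
  have y: "?y \<in> pparts n" "snd ` ?y = {1..n} - snd ` set u" using final_words[OF w] by auto
  have P: "a \<in> snd ` ?y" "b \<in> snd ` ?y" "d \<in> snd ` ?y" and ne: "a \<noteq> b" "a \<noteq> d" "b \<noteq> d"
    using w unfolding words_two word_ok_two y by auto
  note ne' = ne[symmetric] and inj = merge_inj[OF y(1)]
  have "merge ?y a b \<noteq> merge ?y a d" "merge ?y a b \<noteq> merge ?y b d" "merge ?y a b \<noteq> merge ?y d b"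
    "merge ?y a d \<noteq> merge ?y b d" "merge ?y a d \<noteq> merge ?y d b" "merge ?y b d \<noteq> merge ?y d b"
    using inj[OF P(1,2) ne(1) P(1,3) ne(2)] inj[OF P(1,2) ne(1) P(2,3) ne(3)]
      inj[OF P(1,2) ne(1) P(3,2) ne'(3)] inj[OF P(1,3) ne(2) P(2,3) ne(3)]
      inj[OF P(1,3) ne(2) P(3,2) ne'(3)] inj[OF P(2,3) ne(3) P(3,2) ne'(3)] ne by blast+
  then show ?thesis
    unfolding fillings_between[OF c] interval_triple[OF y(1) P ne] chain_of_split
    using merge_triple[OF ne, of ?y] by (simp add: add.assoc)
qed

lemma words_disjoint_swap:
  assumes "u @ (p, q) # (r, s) # v \<in> words n" "{p, q} \<inter> {r, s} = {}"
  shows "u @ (r, s) # (p, q) # v \<in> words n"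
  using assms unfolding words_two word_ok_two by (auto simp: insert_commute)

lemma words_triple:
  assumes "u @ (a, b) # (a, d) # v \<in> words n"
  shows "u @ (a, d) # (a, b) # v \<in> words n" "u @ (b, d) # (a, b) # v \<in> words n"
    "u @ (d, b) # (a, d) # v \<in> words n"
  using assms unfolding words_two word_ok_two by (auto simp: insert_commute)

text \<open>Every gap in a maximal chain is crossed by two consecutive letters. If they involve
  disjoint pairs the interval is a diamond, otherwise it is the interval of a triple.\<close>

lemma cycles_words_iff:
  assumes c: "c \<in> chain_grp n (n - 1)" and n: "n \<ge> 1"
  shows "c \<in> cycles n (n - 1) \<longleftrightarrow>
    (\<forall>u p q r s v. u @ (p, q) # (r, s) # v \<in> words n \<longrightarrow> {p, q} \<inter> {r, s} = {} \<longrightarrow>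
      c (chain_of n (u @ (p, q) # (r, s) # v)) + c (chain_of n (u @ (r, s) # (p, q) # v)) = 0) \<and>
    (\<forall>u a b d v. u @ (a, b) # (a, d) # v \<in> words n \<longrightarrow>
      c (chain_of n (u @ (a, b) # (a, d) # v)) + c (chain_of n (u @ (a, d) # (a, b) # v)) +
      c (chain_of n (u @ (b, d) # (a, b) # v)) + c (chain_of n (u @ (d, b) # (a, d) # v)) = 0)"
  (is "_ \<longleftrightarrow> ?D \<and> ?T")
proof
  assume cyc: "c \<in> cycles n (n - 1)"
  have "fillings n c u (merge (merge (final (pp_max n) u) p q) r s) v = 0"
    if "u @ (p, q) # (r, s) # v \<in> words n" for u p q r s v
  proof -
    have "chain_of n (u @ (p, q) # (r, s) # v) \<in> pchains n (n - 1)"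
      using chain_of_pchains[OF that n] .
    then show ?thesis
      using cyc cycles_top_iff[OF c n] unfolding fillings_def chain_of_split by simp
  qed
  then show "?D \<and> ?T" using fillings_disjoint[OF c] fillings_triple[OF c] by metis
next
  assume R: "?D \<and> ?T"
  show "c \<in> cycles n (n - 1)"
    unfolding cycles_top_iff[OF c n]
  proof (intro allI impI)
    fix T V U assume T: "T \<noteq> []" and U: "U \<noteq> []" and x: "T @ V # U \<in> pchains n (n - 1)"
    obtain w where w: "w \<in> words n" "chain_of n w = T @ V # U"
      using chain_of_surj[OF x n] by blast
    have st: "states (pp_max n) w = rev U @ V # rev T" using w(2) by (simp add: chain_of_def rev_swap)
    \<comment> \<open>The letter at index \<open>k\<close> produces \<open>V\<close>, since
      \<open>U\<close> read backwards consists of the \<open>Suc k\<close> states preceding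
      \<open>V\<close>.\<close>
    define k where "k = length U - 1"
    have l: "length w = length U + length T" using arg_cong[OF st, of length] by simp
    then have kl: "Suc k < length w" "Suc k = length U"
      using T U by (cases T; cases U; simp add: k_def)+
    obtain p q r s where e: "w ! k = (p, q)" "w ! Suc k = (r, s)" by fastforce
    define u v where "u = take k w" and "v = drop (Suc (Suc k)) w"
    have w': "w = u @ (p, q) # (r, s) # v"
      using kl e by (metis Cons_nth_drop_Suc Suc_lessD append_take_drop_id u_def v_def)
    let ?y = "final (pp_max n) u"
    let ?x = "merge (merge ?y p q) r s"
    have "T @ V # U = rev (states ?x v) @ merge ?y p q # rev (prestates (pp_max n) u @ [?y])"
      using w(2) w' chain_of_split by simp
    moreover have "length U = length (rev (prestates (pp_max n) u @ [?y]))"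
      using kl u_def by simp
    ultimately have TU: "T = rev (states ?x v)" "U = rev (prestates (pp_max n) u @ [?y])"
      by (simp_all add: append_eq_append_conv)
    have "fillings n c u ?x v = 0"
    proof -
      have W: "u @ (p, q) # (r, s) # v \<in> words n" using w w' by simp
      then have ne: "p \<noteq> q" "r \<noteq> s" "r \<noteq> q" "s \<noteq> q" unfolding words_two word_ok_two by auto
      consider "r = p" | "s = p" | "{p, q} \<inter> {r, s} = {}" using ne by auto
      then show ?thesis
      proof cases
        case 1
        then show ?thesis using R W fillings_triple[OF c, of u p q s v] by simp
      next
        case 2
        \<comment> \<open>Absorbing \<open>q\<close> into \<open>p\<close> and then \<open>p\<close>
          into \<open>r\<close> ends in the same element as absorbing both into \<open>r\<close>, so
          the relation of the triple with survivor \<open>r\<close> applies.\<close>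
        then have "u @ (r, p) # (r, q) # v \<in> words n"
          using W unfolding words_two word_ok_two by (auto simp: insert_commute)
        moreover have "?x = merge (merge ?y r p) r q"
          using merge_triple(2)[of r p q ?y] ne 2 by simp
        ultimately show ?thesis using R fillings_triple[OF c, of u r p q v] by simp
      next
        case 3
        then show ?thesis using R W fillings_disjoint[OF c W 3] by simp
      qed
    qed
    then show "(\<Sum>v\<in>pparts n. c (T @ v # U)) = 0"
      unfolding fillings_def TU .
  qed
qed

subsection \<open>The sign of a word\<close>

definition listperm :: "nat \<Rightarrow> nat list \<Rightarrow> nat \<Rightarrow> nat" where
  "listperm n L i = (if i \<in> {1..n} then L ! (i - 1) else i)"

definition root :: "nat \<Rightarrow> (nat \<times> nat) list \<Rightarrow> nat" where
  "root n w = the_elem ({1..n} - snd ` set w)"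

text \<open>The sign of the order in which the points disappear in favour of the final one.\<close>

definition eps :: "nat \<Rightarrow> (nat \<times> nat) list \<Rightarrow> int" where
  "eps n w = sign (listperm n (map snd w @ [root n w]))"

lemma word_ok_snd: "word_ok S w \<Longrightarrow> distinct (map snd w) \<and> snd ` set w \<subseteq> S"
  by (induction S w rule: word_ok.induct) auto

lemma root_words:
  assumes w: "w \<in> words n" and n: "n \<ge> 1"
  shows "{1..n} - snd ` set w = {root n w}"
proof -
  have ok: "word_ok {1..n} w" and l: "length w = n - 1" using w by (auto simp: words_def)
  have "card (snd ` set w) = n - 1"
    using word_ok_snd[OF ok] l distinct_card[of "map snd w"] by simp
  then have "card ({1..n} - snd ` set w) = 1"
    using word_ok_snd[OF ok] n by (simp add: card_Diff_subset)
  then obtain r where "{1..n} - snd ` set w = {r}" by (auto simp: card_1_singleton_iff)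
  then show ?thesis by (simp add: root_def)
qed

lemma kills_words:
  assumes w: "w \<in> words n" and n: "n \<ge> 1"
  shows "distinct (map snd w @ [root n w])" "set (map snd w @ [root n w]) = {1..n}"
    "length (map snd w @ [root n w]) = n"
  using root_words[OF assms] word_ok_snd[of "{1..n}" w] assms by (auto simp: words_def)

lemma listperm_permutes:
  assumes "distinct L" "set L = {1..n}"
  shows "listperm n L permutes {1..n}"
proof (rule bij_imp_permutes)
  have l: "length L = n" using distinct_card[OF assms(1)] assms(2) by simp
  have "bij_betw (\<lambda>i. L ! (i - 1)) {1..n} {1..n}"
  proof -
    have "bij_betw (\<lambda>i. i - 1) {1..n} {..<n}"
      by (rule bij_betw_byWitness[of _ Suc]) auto
    moreover have "bij_betw ((!) L) {..<n} {1..n}"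
      using bij_betw_nth[OF assms(1), of "{..<n}" "{1..n}"] l assms(2) by simp
    ultimately show ?thesis using bij_betw_trans by (fastforce simp: o_def)
  qed
  moreover have "bij_betw (listperm n L) {1..n} {1..n} = bij_betw (\<lambda>i. L ! (i - 1)) {1..n} {1..n}"
    by (rule bij_betw_cong) (simp add: listperm_def)
  ultimately show "bij_betw (listperm n L) {1..n} {1..n}" by simp
qed (auto simp: listperm_def)

text \<open>Exchanging neighbouring entries composes the permutation on the right with a
  transposition of positions.\<close>

lemma sign_listperm_swap:
  assumes L: "distinct (u @ x # y # v)" "set (u @ x # y # v) = {1..n}"
  shows "sign (listperm n (u @ y # x # v)) = - sign (listperm n (u @ x # y # v))"
proof -
  let ?L = "u @ x # y # v" and ?k = "Suc (length u)"
  have l: "length ?L = n" using distinct_card[OF L(1)] L(2) by simp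
  have "listperm n (u @ y # x # v) = listperm n ?L \<circ> Transposition.transpose ?k (Suc ?k)"
  proof
    fix i
    consider "i = ?k" | "i = Suc ?k" | "i \<noteq> ?k" "i \<noteq> Suc ?k" by blast
    then show "listperm n (u @ y # x # v) i = (listperm n ?L \<circ> Transposition.transpose ?k (Suc ?k)) i"
    proof cases
      case 3
      have "(u @ y # x # v) ! j = (u @ x # y # v) ! j" if "j \<noteq> length u" "j \<noteq> Suc (length u)" for j
        using that by (auto simp: nth_append nth_Cons split: nat.split)
      from this[of "i - 1"] show ?thesis
        using 3 by (cases i) (auto simp: listperm_def)
    qed (use l in \<open>auto simp: listperm_def nth_append\<close>)
  qed
  moreover have "permutation (listperm n ?L)"
    using listperm_permutes[OF L] by (auto simp: permutation_permutes)
  ultimately show ?thesis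
    by (simp add: sign_compose permutation_swap_id sign_swap_id)
qed

lemma eps_cong: "map snd w = map snd w' \<Longrightarrow> eps n w = eps n w'"
  unfolding eps_def root_def by (metis set_map)

text \<open>\<open>eps\<close> sees only the disappearing points, so the kept points
  \<open>p'\<close> and \<open>r'\<close> are arbitrary. One statement thus covers both the exchange
  of independent letters and the words of a triple.\<close>

lemma eps_swap:
  assumes w: "u @ (p, q) # (r, s) # v \<in> words n" and n: "n \<ge> 1"
  shows "eps n (u @ (p', s) # (r', q) # v) = - eps n (u @ (p, q) # (r, s) # v)"
proof -
  let ?w = "u @ (p, q) # (r, s) # v" and ?w' = "u @ (p', s) # (r', q) # v"
  have "root n ?w' = root n ?w" by (simp add: root_def insert_commute)
  then show ?thesis
    using sign_listperm_swap[of "map snd u" q s "map snd v @ [root n ?w]" n]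
      kills_words[OF w n] by (simp add: eps_def)
qed

lemma eps_square [simp]: "eps n w * eps n w = 1"
  by (simp add: eps_def sign_def)

subsection \<open>Trees and words\<close>

fun point :: "btree \<Rightarrow> nat" where
  "point (Leaf i) = i"
| "point (Node a b) = point a"

text \<open>The inner vertices are listed in postorder, the canonical choice among the orders that
  put children before parents.\<close>

fun word_of :: "btree \<Rightarrow> (nat \<times> nat) list" where
  "word_of (Leaf i) = []"
| "word_of (Node a b) = word_of a @ word_of b @ [(point a, point b)]"

lemma leaves_nonempty [simp]: "leaves t \<noteq> []"
  by (induction t) auto

lemma point_leaves [simp]: "point t \<in> set (leaves t)"
  by (induction t) auto

lemma word_of_letters: "(p, q) \<in> set (word_of t) \<Longrightarrow> p \<in> set (leaves t) \<and> q \<in> set (leaves t)"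
  by (induction t) auto

lemma snd_word_of:
  "distinct (leaves t) \<Longrightarrow> snd ` set (word_of t) = set (leaves t) - {point t}"
proof (induction t)
  case (Node a b)
  have "point b \<notin> set (leaves a)" "point a \<notin> set (leaves b)"
    using Node.prems point_leaves by (auto simp: disjoint_iff)
  then show ?case using Node point_leaves[of b] by (auto simp: image_Un)
qed simp

lemma word_ok_word_of:
  "distinct (leaves t) \<Longrightarrow> set (leaves t) \<subseteq> S \<Longrightarrow> word_ok S (word_of t)"
proof (induction t arbitrary: S)
  case (Node a b)
  have d: "distinct (leaves a)" "distinct (leaves b)" "set (leaves a) \<inter> set (leaves b) = {}"
    using Node.prems by auto
  have "point a \<noteq> point b" using d(3) point_leaves[of a] point_leaves[of b] by (metis disjoint_iff)
  moreover have "point a \<notin> set (leaves b)" "point b \<notin> set (leaves a)"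
    using d(3) point_leaves by (auto simp: disjoint_iff)
  moreover have "point a \<in> S" "point b \<in> S"
    using Node.prems point_leaves[of a] point_leaves[of b] by auto
  moreover have "word_ok S (word_of a)" using Node d by simp
  moreover have "word_ok (S - (set (leaves a) - {point a})) (word_of b)"
    using Node d by (intro Node.IH(2)) auto
  ultimately show ?case using d by (simp add: word_ok_append snd_word_of)
qed simp

lemma length_word_of: "Suc (length (word_of t)) = length (leaves t)"
  by (induction t) auto

lemma mtrees_length: "t \<in> mtrees n \<Longrightarrow> length (leaves t) = n"
  using distinct_card[of "leaves t"] by (simp add: mtrees_def)

lemma word_of_words: "t \<in> mtrees n \<Longrightarrow> word_of t \<in> words n"
  using word_ok_word_of[of t "{1..n}"] length_word_of[of t] mtrees_length[of t n]
  by (simp add: words_def mtrees_def)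

text \<open>The forest obtained by performing the merges on trees; the tree of the block pointed at
  \<open>p\<close> is stored at \<open>p\<close>. Points that are gone carry the dummy value \<open>Leaf 0\<close>.\<close>

fun forest :: "(nat \<Rightarrow> btree) \<Rightarrow> (nat \<times> nat) list \<Rightarrow> nat \<Rightarrow> btree" where
  "forest F [] = F"
| "forest F ((p, q) # w) = forest (F(p := Node (F p) (F q), q := Leaf 0)) w"

definition tree_of :: "nat \<Rightarrow> (nat \<times> nat) list \<Rightarrow> btree" where
  "tree_of n w = forest Leaf w (root n w)"

lemma forest_append: "forest F (u @ v) = forest (forest F u) v"
proof (induction u arbitrary: F)
  case (Cons e u)
  then show ?case by (cases e) (simp add: fun_upd_def)
qed simp

text \<open>The starting forest is arbitrary outside the leaves of \<open>t\<close>, because the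
  right subtree is processed after the left one has already changed the forest.\<close>

lemma forest_word_of:
  assumes "distinct (leaves t)" "\<And>i. i \<in> set (leaves t) \<Longrightarrow> F i = Leaf i"
  shows "forest F (word_of t) =
    (\<lambda>i. if i = point t then t else if i \<in> set (leaves t) then Leaf 0 else F i)"
  using assms
proof (induction t arbitrary: F)
  case (Leaf i)
  then show ?case by auto
next
  case (Node a b)
  let ?G = "\<lambda>i. if i = point a then a else if i \<in> set (leaves a) then Leaf 0 else F i"
  have d: "distinct (leaves a)" "distinct (leaves b)" "set (leaves a) \<inter> set (leaves b) = {}"
    using Node.prems by auto
  have pt: "point a \<notin> set (leaves b)" "point b \<notin> set (leaves a)" "point a \<noteq> point b"
    using d(3) point_leaves[of a] point_leaves[of b] by (metis disjoint_iff)+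
  have "forest F (word_of a) = ?G" using Node d by simp
  moreover have "forest ?G (word_of b) =
      (\<lambda>i. if i = point b then b else if i \<in> set (leaves b) then Leaf 0 else ?G i)"
    using d pt Node.prems by (intro Node.IH(2)) (auto simp: disjoint_iff)
  ultimately have "forest F (word_of (Node a b)) = forest (\<lambda>i. if i = point b then b
      else if i \<in> set (leaves b) then Leaf 0 else ?G i) [(point a, point b)]"
    by (simp add: forest_append del: forest.simps)
  then show ?case using pt by (auto simp: fun_eq_iff)
qed

lemma tree_of_word_of:
  assumes "t \<in> mtrees n"
  shows "tree_of n (word_of t) = t"
proof -
  have t: "distinct (leaves t)" "set (leaves t) = {1..n}" using assms by (auto simp: mtrees_def)
  have "{1..n} - snd ` set (word_of t) = {point t}"
    using snd_word_of[OF t(1)] t point_leaves[of t] by auto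
  then have "root n (word_of t) = point t" by (simp add: root_def)
  then show ?thesis using forest_word_of[OF t(1), of Leaf] by (simp add: tree_of_def)
qed

definition indep :: "nat \<times> nat \<Rightarrow> nat \<times> nat \<Rightarrow> bool" where
  "indep e e' \<longleftrightarrow> {fst e, snd e} \<inter> {fst e', snd e'} = {}"

text \<open>One step of partial commutation; its closure connects each word with the canonical word
  of its tree.\<close>

inductive comm :: "(nat \<times> nat) list \<Rightarrow> (nat \<times> nat) list \<Rightarrow> bool" where
  comm_swap: "indep e e' \<Longrightarrow> comm (u @ e # e' # v) (u @ e' # e # v)"

lemma comm_context: "comm\<^sup>*\<^sup>* x y \<Longrightarrow> comm\<^sup>*\<^sup>* (u @ x @ v) (u @ y @ v)"
proof (induction rule: rtranclp_induct)
  case (step y z)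
  from step(2) obtain e e' u' v' where "indep e e'" "y = u' @ e # e' # v'" "z = u' @ e' # e # v'"
    by (auto elim: comm.cases)
  then have "comm (u @ y @ v) (u @ z @ v)"
    using comm_swap[of e e' "u @ u'" "v' @ v"] by simp
  then show ?case using step by simp
qed simp

lemma comm_move_letter: "(\<And>x. x \<in> set xs \<Longrightarrow> indep x e) \<Longrightarrow> comm\<^sup>*\<^sup>* (xs @ [e]) (e # xs)"
proof (induction xs)
  case (Cons x xs)
  have "comm\<^sup>*\<^sup>* ([x] @ (xs @ [e]) @ []) ([x] @ (e # xs) @ [])"
    by (rule comm_context) (use Cons in auto)
  moreover have "comm (x # e # xs) (e # x # xs)"
    using comm_swap[of x e "[]" xs] Cons.prems by simp
  ultimately show ?case by simp
qed simp

lemma comm_move: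
  "(\<And>x y. x \<in> set xs \<Longrightarrow> y \<in> set ys \<Longrightarrow> indep x y) \<Longrightarrow> comm\<^sup>*\<^sup>* (xs @ ys) (ys @ xs)"
proof (induction ys)
  case (Cons y ys)
  have "comm\<^sup>*\<^sup>* ([] @ (xs @ [y]) @ ys) ([] @ (y # xs) @ ys)"
    by (intro comm_context comm_move_letter) (use Cons in auto)
  moreover have "comm\<^sup>*\<^sup>* ([y] @ (xs @ ys) @ []) ([y] @ (ys @ xs) @ [])"
    by (intro comm_context Cons.IH) (use Cons in auto)
  ultimately show ?case by simp
qed simp

lemma indep_word_of:
  "set (leaves s) \<inter> set (leaves t) = {} \<Longrightarrow> x \<in> set (word_of s) \<Longrightarrow> y \<in> set (word_of t) \<Longrightarrow> indep x y"
  using word_of_letters[of "fst x" "snd x" s] word_of_letters[of "fst y" "snd y" t]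
  by (auto simp: indep_def)

lemma forest_invariant:
  assumes "word_ok S w"
  defines "A \<equiv> \<lambda>w. S - snd ` set w"
  shows "(\<forall>s\<in>A w. point (forest Leaf w s) = s \<and> distinct (leaves (forest Leaf w s))) \<and>
    (\<forall>s\<in>A w. \<forall>t\<in>A w. s \<noteq> t \<longrightarrow> set (leaves (forest Leaf w s)) \<inter> set (leaves (forest Leaf w t)) = {}) \<and>
    (\<Union>s\<in>A w. set (leaves (forest Leaf w s))) = S"
  using assms(1)
proof (induction w rule: rev_induct)
  case Nil
  show ?case by (auto simp: A_def)
next
  case (snoc e w)
  obtain p q where e: "e = (p, q)" by (cases e)
  have ok: "word_ok S w" and pq: "p \<in> A w" "q \<in> A w" "p \<noteq> q"
    using snoc.prems by (auto simp: e word_ok_append A_def)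
  note IH = snoc.IH[OF ok]
  have A: "A (w @ [e]) = A w - {q}" by (auto simp: A_def e)
  let ?F = "forest Leaf w"
  have F: "forest Leaf (w @ [e]) = ?F(p := Node (?F p) (?F q), q := Leaf 0)"
    by (simp add: forest_append e)
  have "(\<Union>s\<in>A w - {q}. set (leaves (forest Leaf (w @ [e]) s))) = (\<Union>s\<in>A w. set (leaves (?F s)))"
  proof -
    define R where "R = A w - {p, q}"
    have AR: "A w = insert p (insert q R)" and AqR: "A w - {q} = insert p R"
      using pq by (auto simp: R_def)
    have "(\<Union>s\<in>R. set (leaves (forest Leaf (w @ [e]) s))) = (\<Union>s\<in>R. set (leaves (?F s)))"
      unfolding F by (rule SUP_cong) (auto simp: R_def)
    moreover have "set (leaves (forest Leaf (w @ [e]) p)) = set (leaves (?F p)) \<union> set (leaves (?F q))"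
      unfolding F using pq by simp
    ultimately show ?thesis unfolding AqR unfolding AR by (simp add: Un_assoc)
  qed
  moreover have "\<forall>s\<in>A w - {q}. point (forest Leaf (w @ [e]) s) = s \<and>
      distinct (leaves (forest Leaf (w @ [e]) s))"
    unfolding F using IH pq by auto
  moreover have "\<forall>s\<in>A w - {q}. \<forall>t\<in>A w - {q}. s \<noteq> t \<longrightarrow>
      set (leaves (forest Leaf (w @ [e]) s)) \<inter> set (leaves (forest Leaf (w @ [e]) t)) = {}"
  proof (intro ballI impI)
    fix s t assume st: "s \<in> A w - {q}" "t \<in> A w - {q}" "s \<noteq> t"
    have L: "set (leaves (forest Leaf (w @ [e]) s)) =
        (if s = p then set (leaves (?F p)) \<union> set (leaves (?F q)) else set (leaves (?F s)))"
      if "s \<noteq> q" for s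
      using that pq by (simp add: F)
    have dj: "set (leaves (?F s)) \<inter> set (leaves (?F t)) = {}" if "s \<in> A w" "t \<in> A w" "s \<noteq> t" for s t
      using IH that by blast
    show "set (leaves (forest Leaf (w @ [e]) s)) \<inter> set (leaves (forest Leaf (w @ [e]) t)) = {}"
      using st pq dj[of s t] dj[of q t] dj[of s q]
      by (cases "s = p"; cases "t = p") (simp_all add: L Int_Un_distrib Int_Un_distrib2)
  qed
  ultimately show ?case using IH A by simp
qed

text \<open>The order \<open>xs\<close> of the surviving points is arbitrary, so that in the
  induction step \<open>q\<close> can be placed directly behind \<open>p\<close>; the new letter
  then completes the postorder word of the joined tree.\<close>

lemma comm_forest:
  assumes "word_ok S w" "distinct xs" "set xs = S - snd ` set w"
  shows "comm\<^sup>*\<^sup>* w (concat (map (\<lambda>s. word_of (forest Leaf w s)) xs))"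
  using assms
proof (induction w arbitrary: xs rule: rev_induct)
  case Nil
  have "concat (map (\<lambda>s. []) xs) = ([] :: (nat \<times> nat) list)" by (induction xs) auto
  then have "concat (map (\<lambda>s. word_of (forest Leaf [] s)) xs) = []" by (simp only: forest.simps word_of.simps)
  then show ?case by (simp only: rtranclp.rtrancl_refl)
next
  case (snoc e w)
  obtain p q where e: "e = (p, q)" by (cases e)
  have ok: "word_ok S w" and pq: "p \<in> S - snd ` set w" "q \<in> S - snd ` set w" "p \<noteq> q"
    using snoc.prems by (auto simp: e word_ok_append)
  let ?F = "forest Leaf w" and ?W = "\<lambda>xs. concat (map (\<lambda>s. word_of (forest Leaf w s)) xs)"
  have F: "forest Leaf (w @ [e]) = ?F(p := Node (?F p) (?F q), q := Leaf 0)"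
    by (simp add: forest_append e)
  have sx: "set xs = S - snd ` set w - {q}" using snoc.prems by (auto simp: e)
  then obtain xs1 xs2 where xs: "xs = xs1 @ p # xs2" using pq by (metis Diff_iff singletonD split_list)
  have d: "distinct (xs1 @ p # q # xs2)" using snoc.prems sx unfolding xs by auto
  have s: "set (xs1 @ p # q # xs2) = S - snd ` set w" using sx pq unfolding xs by auto
  have "comm\<^sup>*\<^sup>* w (?W (xs1 @ p # q # xs2))" using snoc.IH[OF ok d s] .
  then have "comm\<^sup>*\<^sup>* ([] @ w @ [e]) ([] @ ?W (xs1 @ p # q # xs2) @ [e])" by (rule comm_context)
  \<comment> \<open>The letter \<open>(p, q)\<close> passes the trees listed in \<open>xs2\<close>,
    whose leaves are disjoint from those of the trees at \<open>p\<close> and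
    \<open>q\<close>.\<close>
  moreover have "comm\<^sup>*\<^sup>* (?W (xs1 @ [p, q]) @ (?W xs2 @ [e]) @ []) (?W (xs1 @ [p, q]) @ (e # ?W xs2) @ [])"
  proof (intro comm_context comm_move_letter)
    fix x assume "x \<in> set (?W xs2)"
    then obtain t where t: "t \<in> set xs2" "x \<in> set (word_of (?F t))" by auto
    then have "t \<noteq> p" "t \<noteq> q" "t \<in> S - snd ` set w" using d s by auto
    then have "set (leaves (?F t)) \<inter> set (leaves (?F p)) = {}"
      "set (leaves (?F t)) \<inter> set (leaves (?F q)) = {}"
      using forest_invariant[OF ok] pq by blast+
    moreover have "p \<in> set (leaves (?F p))" "q \<in> set (leaves (?F q))"
      using forest_invariant[OF ok] pq point_leaves by metis+
    ultimately show "indep x e"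
      using word_of_letters[of "fst x" "snd x" "?F t"] t by (auto simp: indep_def e)
  qed
  moreover have "?W (xs1 @ [p, q]) @ e # ?W xs2 = concat (map (\<lambda>s. word_of (forest Leaf (w @ [e]) s)) xs)"
  proof -
    have "map (\<lambda>s. word_of (forest Leaf (w @ [e]) s)) ys = map (\<lambda>s. word_of (?F s)) ys"
      if "p \<notin> set ys" "q \<notin> set ys" for ys
      unfolding F using that by (intro map_cong) auto
    from this[of xs1] this[of xs2]
    have "map (\<lambda>s. word_of (forest Leaf (w @ [e]) s)) xs1 = map (\<lambda>s. word_of (?F s)) xs1"
      "map (\<lambda>s. word_of (forest Leaf (w @ [e]) s)) xs2 = map (\<lambda>s. word_of (?F s)) xs2"
      using d by auto
    moreover have "word_of (forest Leaf (w @ [e]) p) = word_of (?F p) @ word_of (?F q) @ [e]"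
      unfolding F using pq forest_invariant[OF ok] by (simp add: e)
    ultimately show ?thesis by (simp add: xs del: map_eq_conv)
  qed
  ultimately show ?case by simp
qed

lemma tree_of_mtrees:
  assumes "w \<in> words n" "n \<ge> 1"
  shows "tree_of n w \<in> mtrees n"
  using forest_invariant[of "{1..n}" w] root_words[OF assms] assms
  by (simp add: mtrees_def tree_of_def words_def)

lemma comm_tree_of:
  assumes "w \<in> words n" "n \<ge> 1"
  shows "comm\<^sup>*\<^sup>* w (word_of (tree_of n w))"
  using comm_forest[of "{1..n}" w "[root n w]"] root_words[OF assms] assms
  by (simp add: words_def tree_of_def)

subsection \<open>Trees in contexts\<close>

fun ctx_comp :: "bctx \<Rightarrow> bctx \<Rightarrow> bctx" where
  "ctx_comp Hole L = L"
| "ctx_comp (CL K b) L = CL (ctx_comp K L) b"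
| "ctx_comp (CR a K) L = CR a (ctx_comp K L)"

lemma fill_ctx_comp [simp]: "fill (ctx_comp K L) t = fill K (fill L t)"
  by (induction K) auto

text \<open>The context is chosen before the tree \<open>t\<close>, so that a single
  \<open>K\<close> serves all four words of a triple.\<close>

lemma forest_context:
  assumes "word_ok S v" "a \<in> S" "S - snd ` set v = {r}"
  shows "\<exists>K. \<forall>t. forest (F(a := t)) v r = fill K t"
  using assms
proof (induction v arbitrary: S a F)
  case Nil
  then have "\<forall>t. forest (F(a := t)) [] r = fill Hole t" by simp
  then show ?case by blast
next
  case (Cons e v)
  obtain p q where e: "e = (p, q)" by (cases e)
  have ok: "p \<in> S" "q \<in> S" "p \<noteq> q" "word_ok (S - {q}) v" using Cons.prems by (auto simp: e)
  have r: "S - {q} - snd ` set v = {r}" using Cons.prems by (auto simp: e)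
  let ?F' = "F(q := Leaf 0)"
  have IH: "\<exists>K. \<forall>t. forest (G(b := t)) v r = fill K t" if "b \<in> S - {q}" for b G
    using Cons.IH[OF ok(4) that r] .
  consider "a = p" | "a = q" | "a \<noteq> p" "a \<noteq> q" by blast
  then show ?case
  proof cases
    case 1
    obtain K where K: "\<And>t. forest (?F'(p := t)) v r = fill K t" using IH[of p ?F'] ok by auto
    have "(F(a := t))(p := Node ((F(a := t)) p) ((F(a := t)) q), q := Leaf 0)
        = ?F'(p := Node t (F q))" for t
      using 1 ok by (auto simp: fun_eq_iff)
    then have "forest (F(a := t)) (e # v) r = fill (ctx_comp K (CL Hole (F q))) t" for t
      unfolding e forest.simps by (simp only: K fill_ctx_comp fill.simps)
    then show ?thesis by blast
  next
    case 2
    obtain K where K: "\<And>t. forest (?F'(p := t)) v r = fill K t" using IH[of p ?F'] ok by auto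
    have "(F(a := t))(p := Node ((F(a := t)) p) ((F(a := t)) q), q := Leaf 0)
        = ?F'(p := Node (F p) t)" for t
      using 2 ok by (auto simp: fun_eq_iff)
    then have "forest (F(a := t)) (e # v) r = fill (ctx_comp K (CR (F p) Hole)) t" for t
      unfolding e forest.simps by (simp only: K fill_ctx_comp fill.simps)
    then show ?thesis by blast
  next
    case 3
    let ?G = "F(p := Node (F p) (F q), q := Leaf 0)"
    obtain K where K: "\<And>t. forest (?G(a := t)) v r = fill K t"
      using IH[of a ?G] 3 Cons.prems by auto
    have "(F(a := t))(p := Node ((F(a := t)) p) ((F(a := t)) q), q := Leaf 0) = ?G(a := t)" for t
      using 3 ok by (auto simp: fun_eq_iff)
    then have "forest (F(a := t)) (e # v) r = fill K t" for t
      unfolding e forest.simps by (simp only: K)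
    then show ?thesis by blast
  qed
qed

lemma tree_of_disjoint_swap:
  assumes "{p, q} \<inter> {r, s} = {}"
  shows "tree_of n (u @ (p, q) # (r, s) # v) = tree_of n (u @ (r, s) # (p, q) # v)"
proof -
  have "root n (u @ (p, q) # (r, s) # v) = root n (u @ (r, s) # (p, q) # v)"
    by (simp add: root_def insert_commute)
  moreover have "forest F ((p, q) # (r, s) # v) = forest F ((r, s) # (p, q) # v)" for F
  proof -
    have "F(p := Node (F p) (F q), q := Leaf 0, r := Node (F r) (F s), s := Leaf 0) =
        F(r := Node (F r) (F s), s := Leaf 0, p := Node (F p) (F q), q := Leaf 0)"
      using assms by (auto simp: fun_eq_iff)
    moreover have "p \<noteq> r" "p \<noteq> s" "q \<noteq> r" "q \<noteq> s" using assms by auto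
    ultimately show ?thesis by simp
  qed
  ultimately show ?thesis by (simp only: tree_of_def forest_append)
qed

text \<open>After the two letters the four forests differ only at \<open>a\<close>: the entries at
  \<open>b\<close> and \<open>d\<close> are dummies in each. The common remainder \<open>v\<close>
  then builds the same context around the entry at \<open>a\<close>.\<close>

lemma tree_of_triple:
  assumes w: "u @ (a, b) # (a, d) # v \<in> words n" and n: "n \<ge> 1"
  shows "\<exists>K A B D. tree_of n (u @ (a, b) # (a, d) # v) = fill K (Node (Node A B) D) \<and>
    tree_of n (u @ (a, d) # (a, b) # v) = fill K (Node (Node A D) B) \<and>
    tree_of n (u @ (b, d) # (a, b) # v) = fill K (Node A (Node B D)) \<and>
    tree_of n (u @ (d, b) # (a, d) # v) = fill K (Node A (Node D B))"
proof -
  let ?r = "root n (u @ (a, b) # (a, d) # v)" and ?S = "{1..n} - snd ` set u - {b, d}"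
  let ?F = "forest Leaf u"
  let ?G = "?F(b := Leaf 0, d := Leaf 0)"
  have ok: "a \<noteq> b" "a \<noteq> d" "b \<noteq> d" "a \<in> ?S" "word_ok ?S v"
    using w unfolding words_two word_ok_two by auto
  have "?S - snd ` set v = {1..n} - snd ` set (u @ (a, b) # (a, d) # v)" by auto
  then have "?S - snd ` set v = {?r}" using root_words[OF w n] by simp
  from forest_context[OF ok(5,4) this, of ?G] obtain K where
    K: "\<And>t. forest (?G(a := t)) v ?r = fill K t" by blast
  have r: "root n (u @ (a, d) # (a, b) # v) = ?r" "root n (u @ (b, d) # (a, b) # v) = ?r"
    "root n (u @ (d, b) # (a, d) # v) = ?r"
    by (simp_all add: root_def insert_commute)
  have "?F(a := Node (?F a) (?F b), b := Leaf 0, a := Node (Node (?F a) (?F b)) (?F d), d := Leaf 0)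
      = ?G(a := Node (Node (?F a) (?F b)) (?F d))"
    "?F(a := Node (?F a) (?F d), d := Leaf 0, a := Node (Node (?F a) (?F d)) (?F b), b := Leaf 0)
      = ?G(a := Node (Node (?F a) (?F d)) (?F b))"
    "?F(b := Node (?F b) (?F d), d := Leaf 0, a := Node (?F a) (Node (?F b) (?F d)), b := Leaf 0)
      = ?G(a := Node (?F a) (Node (?F b) (?F d)))"
    "?F(d := Node (?F d) (?F b), b := Leaf 0, a := Node (?F a) (Node (?F d) (?F b)), d := Leaf 0)
      = ?G(a := Node (?F a) (Node (?F d) (?F b)))"
    using ok by (auto simp: fun_eq_iff)
  then have "tree_of n (u @ (a, b) # (a, d) # v) = fill K (Node (Node (?F a) (?F b)) (?F d))"
    "tree_of n (u @ (a, d) # (a, b) # v) = fill K (Node (Node (?F a) (?F d)) (?F b))"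
    "tree_of n (u @ (b, d) # (a, b) # v) = fill K (Node (?F a) (Node (?F b) (?F d)))"
    "tree_of n (u @ (d, b) # (a, d) # v) = fill K (Node (?F a) (Node (?F d) (?F b)))"
    unfolding tree_of_def r forest_append using ok K by simp_all
  then show ?thesis by blast
qed

section \<open>The canonical word of a tree in a context\<close>

fun ctx_point :: "bctx \<Rightarrow> nat \<Rightarrow> nat" where
  "ctx_point Hole p = p"
| "ctx_point (CL K b) p = ctx_point K p"
| "ctx_point (CR a K) p = point a"

fun ctx_pre :: "bctx \<Rightarrow> (nat \<times> nat) list" where
  "ctx_pre Hole = []"
| "ctx_pre (CL K b) = ctx_pre K"
| "ctx_pre (CR a K) = word_of a @ ctx_pre K"

fun ctx_post :: "bctx \<Rightarrow> nat \<Rightarrow> (nat \<times> nat) list" where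
  "ctx_post Hole p = []"
| "ctx_post (CL K b) p = ctx_post K p @ word_of b @ [(ctx_point K p, point b)]"
| "ctx_post (CR a K) p = ctx_post K p @ [(point a, ctx_point K p)]"

lemma point_fill: "point (fill K t) = ctx_point K (point t)"
  by (induction K) auto

text \<open>The inserted tree affects the rest of the word only through its point. The four
  monomials of a PreLie relation have the same point, so their words share prefix and
  suffix.\<close>

lemma word_of_fill: "word_of (fill K t) = ctx_pre K @ word_of t @ ctx_post K (point t)"
  by (induction K) (auto simp: point_fill)

lemma distinct_leaves_fill: "distinct (leaves (fill K t)) \<Longrightarrow> distinct (leaves t)"
  by (induction K) auto

lemma mset_leaves_fill:
  "mset (leaves s) = mset (leaves t) \<Longrightarrow> mset (leaves (fill K s)) = mset (leaves (fill K t))"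
  by (induction K) auto

lemma mtrees_fill:
  assumes "fill K s \<in> mtrees n" "mset (leaves s) = mset (leaves t)"
  shows "fill K t \<in> mtrees n"
proof -
  have "mset (leaves (fill K s)) = mset (leaves (fill K t))" using assms mset_leaves_fill by blast
  from mset_eq_imp_distinct_iff[OF this] mset_eq_setD[OF this] show ?thesis
    using assms(1) by (simp add: mtrees_def)
qed

section \<open>Finiteness of the monomials, and the dual as a system of equations\<close>

lemma finite_trees: "finite {t. set (leaves t) \<subseteq> A \<and> length (leaves t) \<le> k}" if "finite A"
proof (induction k)
  case 0
  then show ?case by simp
next
  case (Suc k)
  let ?X = "{t. set (leaves t) \<subseteq> A \<and> length (leaves t) \<le> k}"
  have "{t. set (leaves t) \<subseteq> A \<and> length (leaves t) \<le> Suc k} \<subseteq>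
      Leaf ` A \<union> (\<lambda>(a, b). Node a b) ` (?X \<times> ?X)"
  proof
    fix t assume t: "t \<in> {t. set (leaves t) \<subseteq> A \<and> length (leaves t) \<le> Suc k}"
    show "t \<in> Leaf ` A \<union> (\<lambda>(a, b). Node a b) ` (?X \<times> ?X)"
    proof (cases t)
      case (Node a b)
      have "length (leaves a) \<le> k" "length (leaves b) \<le> k"
        using t Node length_word_of[of a] length_word_of[of b] by auto
      then have "a \<in> ?X" "b \<in> ?X" using t Node by auto
      then show ?thesis using Node by auto
    qed (use t in auto)
  qed
  then show ?case by (rule finite_subset) (use Suc that in auto)
qed

lemma finite_mtrees [simp]: "finite (mtrees n)"
  by (rule finite_subset[OF _ finite_trees[of "{1..n}" n]])
    (use mtrees_length in \<open>auto simp: mtrees_def\<close>)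

text \<open>A linear form vanishes on the span of the generators iff it vanishes on each of them,
  and pairing with a generator evaluates the form at four monomials.\<close>

lemma prelie_dual_iff:
  "f \<in> prelie_dual n \<longleftrightarrow> (\<forall>t. t \<notin> mtrees n \<longrightarrow> f t = 0) \<and>
    (\<forall>K a b c. fill K (Node (Node a b) c) \<in> mtrees n \<longrightarrow>
      f (fill K (Node (Node a b) c)) - f (fill K (Node a (Node b c)))
      - f (fill K (Node (Node a c) b)) + f (fill K (Node a (Node c b))) = 0)"
proof -
  have gen: "(\<Sum>t\<in>mtrees n. prelie_gen K a b c t * f t) =
      f (fill K (Node (Node a b) c)) - f (fill K (Node a (Node b c)))
      - f (fill K (Node (Node a c) b)) + f (fill K (Node a (Node c b)))"
    if "fill K (Node (Node a b) c) \<in> mtrees n" for K a b c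
  proof -
    have i: "(\<Sum>t\<in>mtrees n. ind s t * f t) = f s" if "s \<in> mtrees n" for s
    proof -
      have "(\<Sum>t\<in>mtrees n. ind s t * f t) = (\<Sum>t\<in>mtrees n. if t = s then f t else 0)"
        by (rule sum.cong) (auto simp: ind_def)
      then show ?thesis using that by (simp add: sum.delta)
    qed
    have "fill K (Node a (Node b c)) \<in> mtrees n" "fill K (Node (Node a c) b) \<in> mtrees n"
      "fill K (Node a (Node c b)) \<in> mtrees n"
      by (rule mtrees_fill[OF that]; simp)+
    then show ?thesis
      using i that unfolding prelie_gen_def
      by (simp add: algebra_simps sum.distrib sum_subtractf)
  qed
  have "(\<forall>r\<in>prelie_rel n. (\<Sum>t\<in>mtrees n. r t * f t) = 0) \<longleftrightarrow>
      (\<forall>g\<in>prelie_gens n. (\<Sum>t\<in>mtrees n. g t * f t) = 0)"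
  proof (intro iffI ballI)
    fix g :: "btree \<Rightarrow> 'a"
    assume R: "\<forall>r\<in>prelie_rel n. (\<Sum>t\<in>mtrees n. r t * f t) = 0" and g: "g \<in> prelie_gens n"
    have "(\<lambda>s. 1 * g s + 0) \<in> prelie_rel n"
      using prelie_rel.step[OF g prelie_rel.zero] .
    then show "(\<Sum>t\<in>mtrees n. g t * f t) = 0" using R by auto
  next
    fix r :: "btree \<Rightarrow> 'a"
    assume G: "\<forall>g\<in>prelie_gens n. (\<Sum>t\<in>mtrees n. g t * f t) = 0" and "r \<in> prelie_rel n"
    from this(2) show "(\<Sum>t\<in>mtrees n. r t * f t) = 0"
    proof induction
      case (step g r a)
      have "(\<Sum>t\<in>mtrees n. (a * g t + r t) * f t) =
          a * (\<Sum>t\<in>mtrees n. g t * f t) + (\<Sum>t\<in>mtrees n. r t * f t)"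
        by (simp add: algebra_simps sum.distrib sum_distrib_left)
      then show ?case using G step by simp
    qed simp
  qed
  also have "\<dots> \<longleftrightarrow> (\<forall>K a b c. fill K (Node (Node a b) c) \<in> mtrees n \<longrightarrow>
      (\<Sum>t\<in>mtrees n. prelie_gen K a b c t * f t) = 0)"
    unfolding prelie_gens_def by blast
  finally show ?thesis unfolding prelie_dual_def using gen by auto
qed

subsection \<open>The isomorphism in top degree\<close>

definition top_map :: "nat \<Rightarrow> (ppart list \<Rightarrow> 'k::comm_ring_1) \<Rightarrow> btree \<Rightarrow> 'k" where
  "top_map n c t =
    (if t \<in> mtrees n then of_int (eps n (word_of t)) * c (chain_of n (word_of t)) else 0)"

lemma eps_cancel [simp]: "of_int (eps n w) * (of_int (eps n w) * x) = (x :: 'k::comm_ring_1)"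
proof -
  have "of_int (eps n w) * (of_int (eps n w) * x) = of_int (eps n w * eps n w) * x"
    by (simp only: of_int_mult mult.assoc)
  then show ?thesis by simp
qed

text \<open>An exchange of independent letters reverses the sign of \<open>c\<close> by the cycle
  condition and the sign of \<open>eps\<close> by \<open>eps_swap\<close>, so their product is
  invariant.\<close>

lemma comm_words:
  assumes c: "c \<in> cycles n (n - 1)" and n: "n \<ge> 1" and w: "w \<in> words n" and "comm w w'"
  shows "w' \<in> words n \<and> of_int (eps n w') * c (chain_of n w') = of_int (eps n w) * c (chain_of n w)"
proof -
  obtain u p q r s v where e: "indep (p, q) (r, s)" "w = u @ (p, q) # (r, s) # v"
    "w' = u @ (r, s) # (p, q) # v"
    using assms(4) by (auto elim!: comm.cases)
  then have d: "{p, q} \<inter> {r, s} = {}" by (simp add: indep_def)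
  have c': "c \<in> chain_grp n (n - 1)" using c by (simp add: cycles_def)
  have "c (chain_of n w) + c (chain_of n w') = 0"
    using cycles_words_iff[OF c' n] c w d e by blast
  then have "c (chain_of n w') = - c (chain_of n w)" by (simp add: add_eq_0_iff)
  moreover have "eps n w' = - eps n w" using eps_swap w n e by blast
  ultimately show ?thesis using words_disjoint_swap w d e by simp
qed

lemma comm_words_rtrancl:
  assumes c: "c \<in> cycles n (n - 1)" and n: "n \<ge> 1" and w: "w \<in> words n" and "comm\<^sup>*\<^sup>* w w'"
  shows "w' \<in> words n \<and> of_int (eps n w') * c (chain_of n w') = of_int (eps n w) * c (chain_of n w)"
  using assms(4)
proof induction
  case base
  then show ?case using w by simp
next
  case (step y z)
  then show ?case using comm_words[OF c n, of y z] by simp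
qed

lemma top_map_comm:
  assumes c: "c \<in> cycles n (n - 1)" and n: "n \<ge> 1" and t: "t \<in> mtrees n"
    and "comm\<^sup>*\<^sup>* (word_of t) w"
  shows "w \<in> words n \<and> top_map n c t = of_int (eps n w) * c (chain_of n w)"
  using comm_words_rtrancl[OF c n word_of_words[OF t] assms(4)] t by (simp add: top_map_def)

lemma top_map_tree_of:
  assumes c: "c \<in> cycles n (n - 1)" and n: "n \<ge> 1" and w: "w \<in> words n"
  shows "top_map n c (tree_of n w) = of_int (eps n w) * c (chain_of n w)"
  using comm_words_rtrancl[OF c n w comm_tree_of[OF w n]] tree_of_mtrees[OF w n]
  by (simp add: top_map_def)

text \<open>The canonical words of the four monomials are brought by exchanges to a common prefix
  \<open>u\<close>, two letters, and a common suffix \<open>v\<close>; there the cycle condition of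
  a triple can be read off.\<close>

lemma top_map_dual:
  assumes c: "c \<in> cycles n (n - 1)" and n: "n \<ge> 1"
  shows "top_map n c \<in> prelie_dual n"
  unfolding prelie_dual_iff
proof (intro conjI allI impI)
  show "top_map n c t = 0" if "t \<notin> mtrees n" for t using that by (simp add: top_map_def)
  fix K A B D assume T: "fill K (Node (Node A B) D) \<in> mtrees n" (is "?t1 \<in> _")
  let ?t2 = "fill K (Node (Node A D) B)" and ?t3 = "fill K (Node A (Node B D))"
    and ?t4 = "fill K (Node A (Node D B))"
  have T': "?t2 \<in> mtrees n" "?t3 \<in> mtrees n" "?t4 \<in> mtrees n"
    by (rule mtrees_fill[OF T]; simp)+
  have "distinct (leaves (Node (Node A B) D))"
    using T distinct_leaves_fill[of K "Node (Node A B) D"] by (simp add: mtrees_def)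
  then have AB: "set (leaves A) \<inter> set (leaves B) = {}" and AD: "set (leaves A) \<inter> set (leaves D) = {}"
    and BD: "set (leaves B) \<inter> set (leaves D) = {}" by auto
  define a b d where "a = point A" and "b = point B" and "d = point D"
  \<comment> \<open>All merges inside \<open>A\<close>, \<open>B\<close> and \<open>D\<close> are
    performed before the two letters that join these trees.\<close>
  define u v where "u = ctx_pre K @ word_of A @ word_of B @ word_of D" and "v = ctx_post K a"
  have pts: "a \<notin> set (leaves D)" "b \<notin> set (leaves D)" "a \<notin> set (leaves B)" "d \<notin> set (leaves B)"
    unfolding a_def b_def d_def using AB AD BD point_leaves by (metis disjoint_iff)+
  have ind1: "indep x (a, b)" if "x \<in> set (word_of D)" for x
    using word_of_letters[of "fst x" "snd x" D] that pts by (auto simp: indep_def)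
  have ind2: "indep x (a, d)" if "x \<in> set (word_of B)" for x
    using word_of_letters[of "fst x" "snd x" B] that pts by (auto simp: indep_def)
  have sym: "indep x y \<Longrightarrow> indep y x" for x y by (auto simp: indep_def)
  have BD_swap: "comm\<^sup>*\<^sup>* (X @ (word_of D @ word_of B) @ Y) (X @ (word_of B @ word_of D) @ Y)" for X Y
    by (intro comm_context comm_move indep_word_of) (use BD in auto)
  have "comm\<^sup>*\<^sup>* ((ctx_pre K @ word_of A @ word_of B) @ ([(a, b)] @ word_of D) @ ((a, d) # v))
      ((ctx_pre K @ word_of A @ word_of B) @ (word_of D @ [(a, b)]) @ ((a, d) # v))"
    by (intro comm_context comm_move) (use ind1 sym in auto)
  then have w1: "comm\<^sup>*\<^sup>* (word_of ?t1) (u @ (a, b) # (a, d) # v)"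
    by (simp add: word_of_fill u_def v_def a_def b_def d_def)
  have "comm\<^sup>*\<^sup>* ((ctx_pre K @ word_of A @ word_of D) @ ([(a, d)] @ word_of B) @ ((a, b) # v))
      ((ctx_pre K @ word_of A @ word_of D) @ (word_of B @ [(a, d)]) @ ((a, b) # v))"
    by (intro comm_context comm_move) (use ind2 sym in auto)
  also have "comm\<^sup>*\<^sup>* \<dots> (u @ (a, d) # (a, b) # v)"
    using BD_swap[of "ctx_pre K @ word_of A" "(a, d) # (a, b) # v"] by (simp add: u_def)
  finally have w2: "comm\<^sup>*\<^sup>* (word_of ?t2) (u @ (a, d) # (a, b) # v)"
    by (simp add: word_of_fill v_def a_def b_def d_def)
  have w3: "comm\<^sup>*\<^sup>* (word_of ?t3) (u @ (b, d) # (a, b) # v)"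
    by (simp add: word_of_fill u_def v_def a_def b_def d_def)
  have w4: "comm\<^sup>*\<^sup>* (word_of ?t4) (u @ (d, b) # (a, d) # v)"
    using BD_swap[of "ctx_pre K @ word_of A" "(d, b) # (a, d) # v"]
    by (simp add: word_of_fill u_def v_def a_def b_def d_def)
  note m = top_map_comm[OF c n]
  let ?c = "\<lambda>w. c (chain_of n w)" and ?e = "of_int (eps n (u @ (a, b) # (a, d) # v)) :: 'a"
  have W: "u @ (a, b) # (a, d) # v \<in> words n" using m[OF T w1] by simp
  \<comment> \<open>The second and third words lose \<open>d\<close> before \<open>b\<close>, the
    fourth loses \<open>b\<close> before \<open>d\<close> like the first.\<close>
  have "eps n (u @ (a, d) # (a, b) # v) = - eps n (u @ (a, b) # (a, d) # v)"
    "eps n (u @ (b, d) # (a, b) # v) = - eps n (u @ (a, b) # (a, d) # v)"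
    "eps n (u @ (d, b) # (a, d) # v) = eps n (u @ (a, b) # (a, d) # v)"
    using eps_swap[OF W n] by (auto intro: eps_cong)
  then have "top_map n c ?t1 = ?e * ?c (u @ (a, b) # (a, d) # v)"
    "top_map n c ?t2 = - (?e * ?c (u @ (a, d) # (a, b) # v))"
    "top_map n c ?t3 = - (?e * ?c (u @ (b, d) # (a, b) # v))"
    "top_map n c ?t4 = ?e * ?c (u @ (d, b) # (a, d) # v)"
    using m[OF T w1] m[OF T'(1) w2] m[OF T'(2) w3] m[OF T'(3) w4] by simp_all
  moreover have "?c (u @ (a, b) # (a, d) # v) + ?c (u @ (a, d) # (a, b) # v) +
      ?c (u @ (b, d) # (a, b) # v) + ?c (u @ (d, b) # (a, d) # v) = 0"
    using cycles_words_iff[of c n] c n W by (simp add: cycles_def)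
  then have "?e * (?c (u @ (a, b) # (a, d) # v) + ?c (u @ (a, d) # (a, b) # v) +
      ?c (u @ (b, d) # (a, b) # v) + ?c (u @ (d, b) # (a, d) # v)) = 0" by simp
  ultimately show "top_map n c ?t1 - top_map n c ?t3 - top_map n c ?t2 + top_map n c ?t4 = 0"
    by (simp add: algebra_simps)
qed

lemma top_map_surj:
  assumes f: "f \<in> prelie_dual n" and n: "n \<ge> 1"
  shows "\<exists>c\<in>cycles n (n - 1). top_map n c = f"
proof -
  \<comment> \<open>A maximal chain comes from exactly one word by \<open>chain_of_inj\<close>, so
    the choice is determined; the value is what \<open>top_map_tree_of\<close> forces on any
    preimage of \<open>f\<close>.\<close>
  define c where "c x = (if x \<in> pchains n (n - 1)
    then let w = (SOME w. w \<in> words n \<and> chain_of n w = x) in of_int (eps n w) * f (tree_of n w)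
    else 0)" for x
  have cw: "c (chain_of n w) = of_int (eps n w) * f (tree_of n w)" if w: "w \<in> words n" for w
  proof -
    have "(SOME w'. w' \<in> words n \<and> chain_of n w' = chain_of n w) = w"
      using w chain_of_inj by (intro some_equality) auto
    then show ?thesis using chain_of_pchains[OF w n] by (simp add: c_def)
  qed
  have cg: "c \<in> chain_grp n (n - 1)" by (simp add: chain_grp_def c_def)
  have "c \<in> cycles n (n - 1)"
    unfolding cycles_words_iff[OF cg n]
  proof (intro conjI allI impI)
    fix u p q r s v
    assume w: "u @ (p, q) # (r, s) # v \<in> words n" and d: "{p, q} \<inter> {r, s} = {}"
    \<comment> \<open>Both words have the same tree while \<open>eps\<close> changes sign, so the
      two values are opposite.\<close>
    show "c (chain_of n (u @ (p, q) # (r, s) # v)) + c (chain_of n (u @ (r, s) # (p, q) # v)) = 0"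
      using cw[OF w] cw[OF words_disjoint_swap[OF w d]] tree_of_disjoint_swap[OF d, of n u v]
        eps_swap[OF w n, of r p] by simp
  next
    fix u a b d v
    assume w: "u @ (a, b) # (a, d) # v \<in> words n" (is "?w1 \<in> _")
    let ?w2 = "u @ (a, d) # (a, b) # v" and ?w3 = "u @ (b, d) # (a, b) # v"
      and ?w4 = "u @ (d, b) # (a, d) # v"
    let ?e = "of_int (eps n ?w1) :: 'a"
    obtain K A B D where t: "tree_of n ?w1 = fill K (Node (Node A B) D)"
      "tree_of n ?w2 = fill K (Node (Node A D) B)" "tree_of n ?w3 = fill K (Node A (Node B D))"
      "tree_of n ?w4 = fill K (Node A (Node D B))"
      using tree_of_triple[OF w n] by blast
    have "eps n ?w2 = - eps n ?w1" "eps n ?w3 = - eps n ?w1" "eps n ?w4 = eps n ?w1"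
      using eps_swap[OF w n] by (auto intro: eps_cong)
    then have "c (chain_of n ?w1) + c (chain_of n ?w2) + c (chain_of n ?w3) + c (chain_of n ?w4) =
        ?e * (f (fill K (Node (Node A B) D)) - f (fill K (Node A (Node B D)))
          - f (fill K (Node (Node A D) B)) + f (fill K (Node A (Node D B))))"
      using cw[OF w] cw[OF words_triple(1)[OF w]] cw[OF words_triple(2)[OF w]]
        cw[OF words_triple(3)[OF w]] t by (simp add: algebra_simps)
    also have "\<dots> = 0"
      using f tree_of_mtrees[OF w n] t unfolding prelie_dual_iff by simp
    finally show "c (chain_of n ?w1) + c (chain_of n ?w2) + c (chain_of n ?w3) + c (chain_of n ?w4) = 0" .
  qed
  moreover have "top_map n c = f"
  proof
    fix t
    show "top_map n c t = f t"
      using f cw[OF word_of_words] tree_of_word_of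
      by (cases "t \<in> mtrees n") (auto simp: top_map_def prelie_dual_iff)
  qed
  ultimately show ?thesis by blast
qed

text \<open>The value of a cycle on any maximal chain is, up to sign, the value of
  \<open>top_map\<close> at the tree of the corresponding word.\<close>

lemma top_map_inj:
  assumes c: "c \<in> cycles n (n - 1)" and n: "n \<ge> 1" and z: "top_map n c = (\<lambda>_. 0)"
  shows "c = (\<lambda>_. 0)"
proof
  fix x
  show "c x = 0"
  proof (cases "x \<in> pchains n (n - 1)")
    case True
    then obtain w where w: "w \<in> words n" "chain_of n w = x" using chain_of_surj n by blast
    have "of_int (eps n w) * (of_int (eps n w) * c (chain_of n w)) = of_int (eps n w) * 0"
      using top_map_tree_of[OF c n w(1)] z by simp
    then show ?thesis using w by simp
  next
    case False
    then show ?thesis using c by (simp add: cycles_def chain_grp_def)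
  qed
qed

text \<open>There are no chains of degree \<open>n\<close>, so no passage to a quotient remains in
  top degree.\<close>

lemma boundaries_top:
  assumes n: "n \<ge> 1"
  shows "(boundaries n (n - 1) :: (ppart list \<Rightarrow> 'k::comm_ring_1) set) = {\<lambda>_. 0}"
proof -
  have "bdry n n c = (\<lambda>_. 0)" for c :: "ppart list \<Rightarrow> 'k"
    using pchains_empty[of n n] n by (simp add: bdry_def)
  moreover have "chain_grp n n \<noteq> ({} :: (ppart list \<Rightarrow> 'k) set)" using chain_grp_zero by blast
  ultimately show ?thesis using n by (simp add: boundaries_def image_constant_conv)
qed

subsection \<open>Equivariance\<close>

context
  fixes \<sigma> :: "nat \<Rightarrow> nat" and n :: nat
  assumes perm: "\<sigma> permutes {1..n}"
begin

lemma blk_relabel: "blk (relabel_pp \<sigma> y) (\<sigma> p) = \<sigma> ` blk y p"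
  using permutes_inj[OF perm] unfolding blk_def relabel_pp_def by (force simp: inj_eq)

lemma relabel_merge:
  "relabel_pp \<sigma> (merge y p q) = merge (relabel_pp \<sigma> y) (\<sigma> p) (\<sigma> q)"
proof -
  have "(D, d) \<in> relabel_pp \<sigma> (merge y p q) \<longleftrightarrow> (D, d) \<in> merge (relabel_pp \<sigma> y) (\<sigma> p) (\<sigma> q)" for D d
  proof -
    have "(D, d) \<in> relabel_pp \<sigma> (merge y p q) \<longleftrightarrow>
        (\<exists>E e. (E, e) \<in> merge y p q \<and> D = \<sigma> ` E \<and> d = \<sigma> e)"
      unfolding relabel_pp_def by auto
    moreover have "(D, d) \<in> relabel_pp \<sigma> y \<longleftrightarrow> (\<exists>E e. (E, e) \<in> y \<and> D = \<sigma> ` E \<and> d = \<sigma> e)"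
      unfolding relabel_pp_def by auto
    ultimately show ?thesis
      unfolding merge_mem blk_relabel image_Un[symmetric] using inj_eq[OF permutes_inj[OF perm]] by metis
  qed
  then show ?thesis by auto
qed

lemma relabel_max: "relabel_pp \<sigma> (pp_max n) = pp_max n"
proof -
  have "relabel_pp \<sigma> (pp_max n) = (\<lambda>i. ({i}, i)) ` \<sigma> ` {1..n}"
    unfolding relabel_pp_def pp_max_def image_image by simp
  then show ?thesis using permutes_image[OF perm] by (simp add: pp_max_def)
qed

lemma states_relabel:
  "map (relabel_pp \<sigma>) (states y w) = states (relabel_pp \<sigma> y) (map (map_prod \<sigma> \<sigma>) w)"
  by (induction y w rule: states.induct) (auto simp: relabel_merge)

lemma chain_of_relabel:
  "map (relabel_pp \<sigma>) (chain_of n w) = chain_of n (map (map_prod \<sigma> \<sigma>) w)"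
  by (simp add: chain_of_def states_relabel relabel_max flip: rev_map)

lemma point_relabel: "point (relabel_t \<sigma> t) = \<sigma> (point t)"
  by (induction t) auto

lemma leaves_relabel: "leaves (relabel_t \<sigma> t) = map \<sigma> (leaves t)"
  by (induction t) auto

lemma word_of_relabel: "word_of (relabel_t \<sigma> t) = map (map_prod \<sigma> \<sigma>) (word_of t)"
  by (induction t) (auto simp: point_relabel)

lemma mtrees_relabel: "relabel_t \<sigma> t \<in> mtrees n \<longleftrightarrow> t \<in> mtrees n"
proof -
  have "\<sigma> ` set (leaves t) = {1..n} \<longleftrightarrow> set (leaves t) = {1..n}"
    using permutes_image[OF perm] permutes_inj[OF perm] by (metis inj_image_eq_iff)
  moreover have "inj_on \<sigma> A" for A using permutes_inj[OF perm] by (rule inj_on_subset) simp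
  ultimately show ?thesis by (simp add: mtrees_def leaves_relabel distinct_map)
qed

text \<open>Relabelling composes \<open>listperm\<close> with \<open>\<sigma>\<close> on the left,
  and the sign is multiplicative.\<close>

lemma eps_relabel:
  assumes w: "w \<in> words n" and n: "n \<ge> 1"
  shows "eps n (map (map_prod \<sigma> \<sigma>) w) = sign \<sigma> * eps n w"
proof -
  let ?L = "map snd w @ [root n w]"
  note k = kills_words[OF w n]
  have "snd ` set (map (map_prod \<sigma> \<sigma>) w) = \<sigma> ` snd ` set w"
    by (simp add: image_image)
  then have "{1..n} - snd ` set (map (map_prod \<sigma> \<sigma>) w) = \<sigma> ` {1..n} - \<sigma> ` snd ` set w"
    by (simp only: permutes_image[OF perm])
  also have "\<dots> = \<sigma> ` ({1..n} - snd ` set w)"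
    by (rule image_set_diff[symmetric]) (rule permutes_inj[OF perm])
  also have "\<dots> = {\<sigma> (root n w)}" unfolding root_words[OF w n] by simp
  finally have "root n (map (map_prod \<sigma> \<sigma>) w) = \<sigma> (root n w)" by (simp add: root_def)
  then have "eps n (map (map_prod \<sigma> \<sigma>) w) = sign (listperm n (map \<sigma> ?L))"
    by (simp add: eps_def o_def)
  also have "listperm n (map \<sigma> ?L) = \<sigma> \<circ> listperm n ?L"
  proof
    fix i
    show "listperm n (map \<sigma> ?L) i = (\<sigma> \<circ> listperm n ?L) i"
    proof (cases "i \<in> {1..n}")
      case True
      then have "i - 1 < length ?L" unfolding k(3) by auto
      then show ?thesis using True nth_map[of "i - 1" ?L \<sigma>] by (simp add: listperm_def)
    next
      case False
      then show ?thesis using permutes_not_in[OF perm] by (auto simp: listperm_def)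
    qed
  qed
  also have "sign \<dots> = sign \<sigma> * eps n w"
    unfolding eps_def
    by (rule sign_compose) (use perm listperm_permutes[OF k(1,2)] in \<open>auto simp: permutation_permutes\<close>)
  finally show ?thesis .
qed

end

text \<open>Canonical words commute with relabelling, so the two sides differ only in signs: the
  factor \<open>sign \<sigma>\<close> of the twisted action cancels the one produced by
  \<open>eps_relabel\<close> for \<open>inv \<sigma>\<close>.\<close>

lemma top_map_equivariant:
  assumes perm: "\<sigma> permutes {1..n}" and n: "n \<ge> 1"
  shows "top_map n (chain_act \<sigma> c) = dual_sgn_act \<sigma> (top_map n c)"
proof
  fix t
  have inv: "inv \<sigma> permutes {1..n}" using permutes_inv[OF perm] .
  have s: "sign (inv \<sigma>) = sign \<sigma>"
    using sign_inverse perm by (auto simp: permutation_permutes)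
  show "top_map n (chain_act \<sigma> c) t = dual_sgn_act \<sigma> (top_map n c) t"
  proof (cases "t \<in> mtrees n")
    case True
    have "sign \<sigma> * (sign \<sigma> * eps n (word_of t)) = eps n (word_of t)" by (simp add: sign_def)
    then have "(of_int (sign \<sigma>) :: 'a) * (of_int (sign \<sigma> * eps n (word_of t))) = of_int (eps n (word_of t))"
      by (metis of_int_mult)
    then show ?thesis
      using True eps_relabel[OF inv word_of_words[OF True] n]
      by (simp add: top_map_def chain_act_def dual_sgn_act_def mtrees_relabel[OF inv]
          word_of_relabel[OF inv] chain_of_relabel[OF inv] s flip: mult.assoc)
  next
    case False
    then show ?thesis by (simp add: top_map_def dual_sgn_act_def mtrees_relabel[OF inv])
  qed
qed

theorem mainTheorem5:
  fixes n l :: nat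
  assumes "admissible_coeffs TYPE('k::comm_ring_1)"
    and "n \<ge> 1"
  shows "(l = n - 1 \<longrightarrow>
            homology_iso n l (prelie_dual n :: (btree \<Rightarrow> 'k) set) dual_sgn_act)
       \<and> (l \<noteq> n - 1 \<longrightarrow> (cycles n l :: (ppart list \<Rightarrow> 'k) set) = boundaries n l)"
proof (intro conjI impI)
  note n = assms(2)
  assume l: "l = n - 1"
  show "homology_iso n l (prelie_dual n :: (btree \<Rightarrow> 'k) set) dual_sgn_act"
    unfolding homology_iso_def l
  proof (intro exI[of _ "top_map n"] conjI ballI allI impI)
    show "top_map n ` cycles n (n - 1) = (prelie_dual n :: (btree \<Rightarrow> 'k) set)"
      using top_map_dual[OF _ n] top_map_surj[OF _ n] by blast
    show "top_map n (\<lambda>x. a * c x + b * d x) = (\<lambda>t. a * top_map n c t + b * top_map n d t)"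
      for c d :: "ppart list \<Rightarrow> 'k" and a b
      by (auto simp: top_map_def algebra_simps)
    show "top_map n c = (\<lambda>_. 0) \<longleftrightarrow> c \<in> boundaries n (n - 1)" if "c \<in> cycles n (n - 1)"
      for c :: "ppart list \<Rightarrow> 'k"
      unfolding boundaries_top[OF n] using top_map_inj[OF that n] by (auto simp: top_map_def)
    show "top_map n (chain_act \<sigma> c) = dual_sgn_act \<sigma> (top_map n c)" if "\<sigma> permutes {1..n}"
      for \<sigma> and c :: "ppart list \<Rightarrow> 'k"
      using top_map_equivariant[OF that n] .
  qed
next
  show "(cycles n l :: (ppart list \<Rightarrow> 'k) set) = boundaries n l" if "l \<noteq> n - 1"
    using cycles_eq_boundaries[OF assms(2) that] .
qed

end
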